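(* Let $\exists\alpha A$ be a formula of $\mathcal L^2$ and suppose $\mathsf{LC}_2\vdash t:\exists\alpha A$ (i.e. $t$ is a proof term of $\mathsf{LC}_2$ of type $\exists\alpha A$ with no free proof variables). Then there is a proof term $u$ such that $t\succ^*u$, $u$ is a head normal form, $\mathsf{LC}_2\vdash u:\exists\alpha A$, and $u$ is an Herbrand normal form $$u=(m_0,v_0)\parallel_{a_1}(m_1,v_1)\parallel_{a_2}\cdots\parallel_{a_k}(m_k,v_k).$$ Moreover, $\mathsf{LC}_2\vdash A[m_0/\alpha]\vee A[m_1/\alpha]\vee\cdots\vee A[m_k/\alpha]$.
   Context: Language $\mathcal L^2$: terms are individual variables $\alpha,\beta,\dots$, constants and $f(m_1,\dots,m_n)$. Atomic formulas are $P(m_1,\dots,m_n)$ for predicate constants $P$ (including $0$-ary $\bot$) and $X(m)$ for predicate variables $X,Y,\dots$; formulas are built with $\wedge,\vee,\to,\forall\alpha,\exists\alpha,\forall X$. $A[\lambda\alpha B/X]$ denotes $A$ with every atomic subformula $X(m)$ replaced by $B[m/\alpha]$ (avoiding capture). Proof terms of $\mathsf{LC}_2$ (Church-typed): $x^A:A$; $\langle u,t\rangle:A\wedge B$; $u\pi_0:A$, $u\pi_1:B$ from $u:A\wedge B$; $tu:B$ from $t:A\to B,u:A$; $\lambda x^Au:A\to B$ from $u:B$; $\iota_0(u),\iota_1(u):A\vee B$; $u[x^A.w_1,y^B.w_2]:C$ from $u:A\vee B$, $w_1,w_2:C$; $um:A[m/\alpha]$ from $u:\forall\alpha A$; $\lambda\alpha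 u:\forall\alpha A$ (eigenvariable condition); $(m,u):\exists\alpha A$ from $u:A[m/\alpha]$; $u[(\alpha,x^A).t]:C$ from $u:\exists\alpha A,t:C$ (eigenvariable condition); $u\parallel_a v:C$ from $u:C,v:C$ with $a$ of type $A\to B$ in $u$ and $B\to A$ in $v$, $\parallel_a$ binding $a$; $\mathsf{efq}_P(u):P$ from $u:\bot$, $P$ atomic; $\Lambda X\,t:\forall X A$ from $t:A$ if $X$ is not free in the types of free proof variables of $t$; $t(\lambda\alpha B):A[\lambda\alpha B/X]$ from $t:\forall XA$. $\mathsf{LC}_2\vdash B$ means $\mathsf{LC}_2\vdash s:B$ for some closed proof term $s$. Stacks: finite sequences $\sigma_1\cdot\ldots\cdot\sigma_n$ of proof terms, terms $m$, $\pi_0,\pi_1$, $[x.u,y.v]$, $[(\alpha,x).v]$, and expressions $(\lambda\alpha B)$; $t\sigma=((t\sigma_1)\ldots)\sigma_n$. Basic reductions: $(\lambda xu)t\mapsto u[t/x]$; $(\lambda\alpha u)m\mapsto u[m/\alpha]$; $(\Lambda Xu)(\lambda\alpha B)\mapsto u[\lambda\alpha B/X]$; $\langle u_0,u_1\rangle\pi_i\mapsto u_i$; $\iota_i(u)[x_0.t_0,x_1.t_1]\mapsto t_i[u/x_i]$; $(m,u)[(\alpha,x).v]\mapsto v[m/\alpha][u/x]$; $(u\parallel_a v)\xi\mapsto u\xi\parallel_a v\xi$ for $\xi$ a proof term, $\pi_i$, $[x.w_1,y.w_2]$ or $[(\alpha,x).w]$ with $a$ not free in $\xi$; $\mathcal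 C[a^{A\to B}u\sigma]\parallel_a v\mapsto\mathcal C[v[\lambda y^Bu/a^{B\to A}]]\parallel_a v$ and $v\parallel_a\mathcal C[a^{A\to B}u\sigma]\mapsto v\parallel_a\mathcal C[v[\lambda y^Bu/a^{B\to A}]]$, where $\mathcal C[\,]=u_1\parallel_{a_1}\cdots[\,]\cdots\parallel_{a_n}u_n$ is a parallel context, $a$ free in $\mathcal C[au\sigma]$, $y$ dummy. Head reduction $\succ$: writing $t=t_1\parallel_{a_1}\cdots\parallel_{a_n}t_{n+1}$ (parallel processes; elementary if not of the form $u\parallel_a v$), the head redex of $t$ is $h$ where $t=h\sigma$ with $h=r\xi$, $\xi$ one stack element and $r$ one of $\lambda xu,\lambda\alpha u,\Lambda Xu,\langle u,v\rangle,\iota_i(u),(m,u),u\parallel_a v$ ($h$ a redex), or $h=t$ if $t=u\parallel_a v$ is a redex; starting symbol: the opening parenthesis of $r\xi$, resp. the leftmost occurrence of $a$ heading an elementary process $a\,s\,\rho$ of $u\parallel_a v$; $t\succ t'$ contracts the head redex with leftmost starting symbol among the head redexes of the parallel processes of $t$; $\succ^*$ is the reflexive-transitive closure; $u$ is a head normal form if no $u'$ has $u\succ u'$. Herbrand normal forms: every proof term $(m,u)$ is one; if $u,v$ are, so is $u\parallel_a v$.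
   Formalization: The permutation (u∥v)ξ ↦ uξ∥vξ is also allowed for ξ a term m or an expression (λαB), as otherwise (u∥v)m may be head normal but not Herbrand; and efq at X(m) becomes, when a compound formula is substituted for X, the derived ex falso term. *)

theory Defs
  imports Main
begin

text \<open>
  Binding is by de Bruijn indices, with three separate index spaces: individual variables,
  (unary) predicate variables and proof variables. An index pointing beyond all enclosing binders
  is a free variable. Environments extended at index 0 are written \<open>case_nat x \<sigma>\<close>,
  i.e. \<open>0 \<mapsto> x\<close> and \<open>Suc n \<mapsto> \<sigma> n\<close>.
\<close>

section \<open>The language\<close>

text \<open>A language is given by the arities of its function and predicate constants;
  constants are function symbols of arity 0.\<close>

record ('f, 'p) lang =
  fun_arity :: "'f \<Rightarrow> nat"
  pred_arity :: "'p \<Rightarrow> nat"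

datatype 'f tm = Var nat | Fn 'f "'f tm list"

datatype ('f, 'p) fm =
    Bot
  | Pred 'p "'f tm list"
  | PVar nat "'f tm"
  | And "('f, 'p) fm" "('f, 'p) fm"
  | Or "('f, 'p) fm" "('f, 'p) fm"
  | Imp "('f, 'p) fm" "('f, 'p) fm"
  | Uni "('f, 'p) fm"
  | Exi "('f, 'p) fm"
  | Uni2 "('f, 'p) fm"  \<comment> \<open>binds a predicate variable\<close>

fun wf_tm :: "('f, 'p) lang \<Rightarrow> 'f tm \<Rightarrow> bool" where
  "wf_tm L (Var n) \<longleftrightarrow> True"
| "wf_tm L (Fn f ms) \<longleftrightarrow> length ms = fun_arity L f \<and> (\<forall>m \<in> set ms. wf_tm L m)"

primrec wf_fm :: "('f, 'p) lang \<Rightarrow> ('f, 'p) fm \<Rightarrow> bool" where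
  "wf_fm L Bot \<longleftrightarrow> True"
| "wf_fm L (Pred p ms) \<longleftrightarrow> length ms = pred_arity L p \<and> (\<forall>m \<in> set ms. wf_tm L m)"
| "wf_fm L (PVar X m) \<longleftrightarrow> wf_tm L m"
| "wf_fm L (And A B) \<longleftrightarrow> wf_fm L A \<and> wf_fm L B"
| "wf_fm L (Or A B) \<longleftrightarrow> wf_fm L A \<and> wf_fm L B"
| "wf_fm L (Imp A B) \<longleftrightarrow> wf_fm L A \<and> wf_fm L B"
| "wf_fm L (Uni A) \<longleftrightarrow> wf_fm L A"
| "wf_fm L (Exi A) \<longleftrightarrow> wf_fm L A"
| "wf_fm L (Uni2 A) \<longleftrightarrow> wf_fm L A"

primrec atomic :: "('f, 'p) fm \<Rightarrow> bool" where
  "atomic Bot \<longleftrightarrow> True"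
| "atomic (Pred p ms) \<longleftrightarrow> True"
| "atomic (PVar X m) \<longleftrightarrow> True"
| "atomic (And A B) \<longleftrightarrow> False"
| "atomic (Or A B) \<longleftrightarrow> False"
| "atomic (Imp A B) \<longleftrightarrow> False"
| "atomic (Uni A) \<longleftrightarrow> False"
| "atomic (Exi A) \<longleftrightarrow> False"
| "atomic (Uni2 A) \<longleftrightarrow> False"


section \<open>Substitution in terms and formulas\<close>

primrec subst_tm :: "(nat \<Rightarrow> 'f tm) \<Rightarrow> 'f tm \<Rightarrow> 'f tm" where
  "subst_tm \<sigma> (Var n) = \<sigma> n"
| "subst_tm \<sigma> (Fn f ms) = Fn f (map (subst_tm \<sigma>) ms)"

definition shift_tm :: "nat \<Rightarrow> 'f tm" where
  "shift_tm n = Var (Suc n)"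

definition up_tm :: "(nat \<Rightarrow> 'f tm) \<Rightarrow> nat \<Rightarrow> 'f tm" where
  "up_tm \<sigma> = case_nat (Var 0) (\<lambda>n. subst_tm shift_tm (\<sigma> n))"

primrec isubst_fm :: "(nat \<Rightarrow> 'f tm) \<Rightarrow> ('f, 'p) fm \<Rightarrow> ('f, 'p) fm" where
  "isubst_fm \<sigma> Bot = Bot"
| "isubst_fm \<sigma> (Pred p ms) = Pred p (map (subst_tm \<sigma>) ms)"
| "isubst_fm \<sigma> (PVar X m) = PVar X (subst_tm \<sigma> m)"
| "isubst_fm \<sigma> (And A B) = And (isubst_fm \<sigma> A) (isubst_fm \<sigma> B)"
| "isubst_fm \<sigma> (Or A B) = Or (isubst_fm \<sigma> A) (isubst_fm \<sigma> B)"
| "isubst_fm \<sigma> (Imp A B) = Imp (isubst_fm \<sigma> A) (isubst_fm \<sigma> B)"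
| "isubst_fm \<sigma> (Uni A) = Uni (isubst_fm (up_tm \<sigma>) A)"
| "isubst_fm \<sigma> (Exi A) = Exi (isubst_fm (up_tm \<sigma>) A)"
| "isubst_fm \<sigma> (Uni2 A) = Uni2 (isubst_fm \<sigma> A)"

text \<open>\<open>A[m/\<alpha>]\<close>, where \<open>\<alpha>\<close> is index 0 of \<open>A\<close>.\<close>

definition inst_fm :: "'f tm \<Rightarrow> ('f, 'p) fm \<Rightarrow> ('f, 'p) fm" where
  "inst_fm m A = isubst_fm (case_nat m Var) A"

definition up_ren :: "(nat \<Rightarrow> nat) \<Rightarrow> nat \<Rightarrow> nat" where
  "up_ren \<rho> = case_nat 0 (\<lambda>n. Suc (\<rho> n))"

text \<open>Renaming of predicate variables.\<close>

primrec pren_fm :: "(nat \<Rightarrow> nat) \<Rightarrow> ('f, 'p) fm \<Rightarrow> ('f, 'p) fm" where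
  "pren_fm \<rho> Bot = Bot"
| "pren_fm \<rho> (Pred p ms) = Pred p ms"
| "pren_fm \<rho> (PVar X m) = PVar (\<rho> X) m"
| "pren_fm \<rho> (And A B) = And (pren_fm \<rho> A) (pren_fm \<rho> B)"
| "pren_fm \<rho> (Or A B) = Or (pren_fm \<rho> A) (pren_fm \<rho> B)"
| "pren_fm \<rho> (Imp A B) = Imp (pren_fm \<rho> A) (pren_fm \<rho> B)"
| "pren_fm \<rho> (Uni A) = Uni (pren_fm \<rho> A)"
| "pren_fm \<rho> (Exi A) = Exi (pren_fm \<rho> A)"
| "pren_fm \<rho> (Uni2 A) = Uni2 (pren_fm (up_ren \<rho>) A)"

text \<open>
  In a predicate substitution \<open>\<theta>\<close>, the formula \<open>\<theta> X\<close> stands for \<open>\<lambda>\<alpha> (\<theta> X)\<close>: its individual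
  index 0 is the abstracted \<open>\<alpha>\<close>, its individual index \<open>Suc n\<close> is the ambient index \<open>n\<close>.
\<close>

definition ilift_ps :: "(nat \<Rightarrow> ('f, 'p) fm) \<Rightarrow> nat \<Rightarrow> ('f, 'p) fm" where
  "ilift_ps \<theta> = (\<lambda>X. isubst_fm (up_tm shift_tm) (\<theta> X))"

definition id_ps :: "nat \<Rightarrow> ('f, 'p) fm" where
  "id_ps X = PVar X (Var 0)"

definition up_ps :: "(nat \<Rightarrow> ('f, 'p) fm) \<Rightarrow> nat \<Rightarrow> ('f, 'p) fm" where
  "up_ps \<theta> = case_nat (id_ps 0) (\<lambda>X. pren_fm Suc (\<theta> X))"

primrec psubst_fm :: "(nat \<Rightarrow> ('f, 'p) fm) \<Rightarrow> ('f, 'p) fm \<Rightarrow> ('f, 'p) fm" where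
  "psubst_fm \<theta> Bot = Bot"
| "psubst_fm \<theta> (Pred p ms) = Pred p ms"
| "psubst_fm \<theta> (PVar X m) = inst_fm m (\<theta> X)"
| "psubst_fm \<theta> (And A B) = And (psubst_fm \<theta> A) (psubst_fm \<theta> B)"
| "psubst_fm \<theta> (Or A B) = Or (psubst_fm \<theta> A) (psubst_fm \<theta> B)"
| "psubst_fm \<theta> (Imp A B) = Imp (psubst_fm \<theta> A) (psubst_fm \<theta> B)"
| "psubst_fm \<theta> (Uni A) = Uni (psubst_fm (ilift_ps \<theta>) A)"
| "psubst_fm \<theta> (Exi A) = Exi (psubst_fm (ilift_ps \<theta>) A)"
| "psubst_fm \<theta> (Uni2 A) = Uni2 (psubst_fm (up_ps \<theta>) A)"

text \<open>\<open>A[\<lambda>\<alpha> B/X]\<close>, where \<open>X\<close> is predicate index 0 of \<open>A\<close> and \<open>\<alpha>\<close> is individual index 0 of \<open>B\<close>.\<close>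

definition pinst_fm :: "('f, 'p) fm \<Rightarrow> ('f, 'p) fm \<Rightarrow> ('f, 'p) fm" where
  "pinst_fm B A = psubst_fm (case_nat B id_ps) A"


section \<open>Proof terms\<close>

text \<open>
  Church-style types are recorded at the binders of proof variables. \<open>Par A B u v\<close> is
  \<open>u \<parallel>\<^sub>a v\<close> with \<open>a\<close> (index 0) of type \<open>A \<rightarrow> B\<close> in \<open>u\<close> and \<open>B \<rightarrow> A\<close> in \<open>v\<close>.
\<close>

datatype ('f, 'p) pt =
    PV nat
  | Tup "('f, 'p) pt" "('f, 'p) pt"
  | Pr0 "('f, 'p) pt"
  | Pr1 "('f, 'p) pt"
  | App "('f, 'p) pt" "('f, 'p) pt"
  | Lam "('f, 'p) fm" "('f, 'p) pt"
  | In0 "('f, 'p) pt"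
  | In1 "('f, 'p) pt"
  | Case "('f, 'p) pt" "('f, 'p) fm" "('f, 'p) pt" "('f, 'p) fm" "('f, 'p) pt"
      \<comment> \<open>\<open>Case u A w\<^sub>1 B w\<^sub>2\<close> is \<open>u[x\<^sup>A. w\<^sub>1, y\<^sup>B. w\<^sub>2]\<close>\<close>
  | IApp "('f, 'p) pt" "'f tm"
  | ILam "('f, 'p) pt"
  | Wit "'f tm" "('f, 'p) pt"
      \<comment> \<open>\<open>Wit m u\<close> is \<open>(m, u)\<close>\<close>
  | ExE "('f, 'p) pt" "('f, 'p) fm" "('f, 'p) pt"
      \<comment> \<open>\<open>ExE u A t\<close> is \<open>u[(\<alpha>, x\<^sup>A). t]\<close>; \<open>\<alpha>\<close> is individual index 0 in \<open>A\<close> and \<open>t\<close>,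
        \<open>x\<close> is proof index 0 in \<open>t\<close>\<close>
  | Par "('f, 'p) fm" "('f, 'p) fm" "('f, 'p) pt" "('f, 'p) pt"
  | Efq "('f, 'p) fm" "('f, 'p) pt"
  | PLam "('f, 'p) pt"
      \<comment> \<open>\<open>\<Lambda>X t\<close>\<close>
  | PApp "('f, 'p) pt" "('f, 'p) fm"
      \<comment> \<open>\<open>PApp t B\<close> is \<open>t(\<lambda>\<alpha> B)\<close>; \<open>\<alpha>\<close> is individual index 0 in \<open>B\<close>\<close>

inductive typing ::
  "('f, 'p) lang \<Rightarrow> ('f, 'p) fm list \<Rightarrow> ('f, 'p) pt \<Rightarrow> ('f, 'p) fm \<Rightarrow> bool"
  for L where
  PV: "i < length \<Gamma> \<Longrightarrow> \<Gamma> ! i = A \<Longrightarrow> typing L \<Gamma> (PV i) A"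
| Tup: "typing L \<Gamma> u A \<Longrightarrow> typing L \<Gamma> t B \<Longrightarrow> typing L \<Gamma> (Tup u t) (And A B)"
| Pr0: "typing L \<Gamma> u (And A B) \<Longrightarrow> typing L \<Gamma> (Pr0 u) A"
| Pr1: "typing L \<Gamma> u (And A B) \<Longrightarrow> typing L \<Gamma> (Pr1 u) B"
| App: "typing L \<Gamma> t (Imp A B) \<Longrightarrow> typing L \<Gamma> u A \<Longrightarrow> typing L \<Gamma> (App t u) B"
| Lam: "wf_fm L A \<Longrightarrow> typing L (A # \<Gamma>) u B \<Longrightarrow> typing L \<Gamma> (Lam A u) (Imp A B)"
| In0: "typing L \<Gamma> u A \<Longrightarrow> wf_fm L B \<Longrightarrow> typing L \<Gamma> (In0 u) (Or A B)"
| In1: "typing L \<Gamma> u B \<Longrightarrow> wf_fm L A \<Longrightarrow> typing L \<Gamma> (In1 u) (Or A B)"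
| Case: "typing L \<Gamma> u (Or A B) \<Longrightarrow> typing L (A # \<Gamma>) w1 C \<Longrightarrow> typing L (B # \<Gamma>) w2 C
    \<Longrightarrow> typing L \<Gamma> (Case u A w1 B w2) C"
| IApp: "typing L \<Gamma> u (Uni A) \<Longrightarrow> wf_tm L m \<Longrightarrow> typing L \<Gamma> (IApp u m) (inst_fm m A)"
| ILam: "typing L (map (isubst_fm shift_tm) \<Gamma>) u A \<Longrightarrow> typing L \<Gamma> (ILam u) (Uni A)"
| Wit: "wf_fm L (Exi A) \<Longrightarrow> wf_tm L m \<Longrightarrow> typing L \<Gamma> u (inst_fm m A) \<Longrightarrow> typing L \<Gamma> (Wit m u) (Exi A)"
| ExE: "typing L \<Gamma> u (Exi A) \<Longrightarrow>
    typing L (A # map (isubst_fm shift_tm) \<Gamma>) t (isubst_fm shift_tm C)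
    \<Longrightarrow> typing L \<Gamma> (ExE u A t) C"
| Par: "wf_fm L A \<Longrightarrow> wf_fm L B \<Longrightarrow>
    typing L (Imp A B # \<Gamma>) u C \<Longrightarrow> typing L (Imp B A # \<Gamma>) v C
    \<Longrightarrow> typing L \<Gamma> (Par A B u v) C"
| Efq: "atomic P \<Longrightarrow> wf_fm L P \<Longrightarrow> typing L \<Gamma> u Bot \<Longrightarrow> typing L \<Gamma> (Efq P u) P"
| PLam: "typing L (map (pren_fm Suc) \<Gamma>) t A \<Longrightarrow> typing L \<Gamma> (PLam t) (Uni2 A)"
| PApp: "typing L \<Gamma> t (Uni2 A) \<Longrightarrow> wf_fm L B \<Longrightarrow> typing L \<Gamma> (PApp t B) (pinst_fm B A)"

definition provable :: "('f, 'p) lang \<Rightarrow> ('f, 'p) fm \<Rightarrow> bool" where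
  "provable L B \<longleftrightarrow> (\<exists>s. typing L [] s B)"


section \<open>Substitution in proof terms\<close>

text \<open>Substitution for individual variables.\<close>

primrec isubst_pt :: "(nat \<Rightarrow> 'f tm) \<Rightarrow> ('f, 'p) pt \<Rightarrow> ('f, 'p) pt" where
  "isubst_pt \<sigma> (PV i) = PV i"
| "isubst_pt \<sigma> (Tup u t) = Tup (isubst_pt \<sigma> u) (isubst_pt \<sigma> t)"
| "isubst_pt \<sigma> (Pr0 u) = Pr0 (isubst_pt \<sigma> u)"
| "isubst_pt \<sigma> (Pr1 u) = Pr1 (isubst_pt \<sigma> u)"
| "isubst_pt \<sigma> (App t u) = App (isubst_pt \<sigma> t) (isubst_pt \<sigma> u)"
| "isubst_pt \<sigma> (Lam A u) = Lam (isubst_fm \<sigma> A) (isubst_pt \<sigma> u)"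
| "isubst_pt \<sigma> (In0 u) = In0 (isubst_pt \<sigma> u)"
| "isubst_pt \<sigma> (In1 u) = In1 (isubst_pt \<sigma> u)"
| "isubst_pt \<sigma> (Case u A w1 B w2) =
    Case (isubst_pt \<sigma> u) (isubst_fm \<sigma> A) (isubst_pt \<sigma> w1) (isubst_fm \<sigma> B) (isubst_pt \<sigma> w2)"
| "isubst_pt \<sigma> (IApp u m) = IApp (isubst_pt \<sigma> u) (subst_tm \<sigma> m)"
| "isubst_pt \<sigma> (ILam u) = ILam (isubst_pt (up_tm \<sigma>) u)"
| "isubst_pt \<sigma> (Wit m u) = Wit (subst_tm \<sigma> m) (isubst_pt \<sigma> u)"
| "isubst_pt \<sigma> (ExE u A t) = ExE (isubst_pt \<sigma> u) (isubst_fm (up_tm \<sigma>) A) (isubst_pt (up_tm \<sigma>) t)"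
| "isubst_pt \<sigma> (Par A B u v) =
    Par (isubst_fm \<sigma> A) (isubst_fm \<sigma> B) (isubst_pt \<sigma> u) (isubst_pt \<sigma> v)"
| "isubst_pt \<sigma> (Efq P u) = Efq (isubst_fm \<sigma> P) (isubst_pt \<sigma> u)"
| "isubst_pt \<sigma> (PLam t) = PLam (isubst_pt \<sigma> t)"
| "isubst_pt \<sigma> (PApp t B) = PApp (isubst_pt \<sigma> t) (isubst_fm (up_tm \<sigma>) B)"

text \<open>Renaming of proof variables.\<close>

primrec ren_pt :: "(nat \<Rightarrow> nat) \<Rightarrow> ('f, 'p) pt \<Rightarrow> ('f, 'p) pt" where
  "ren_pt \<rho> (PV i) = PV (\<rho> i)"
| "ren_pt \<rho> (Tup u t) = Tup (ren_pt \<rho> u) (ren_pt \<rho> t)"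
| "ren_pt \<rho> (Pr0 u) = Pr0 (ren_pt \<rho> u)"
| "ren_pt \<rho> (Pr1 u) = Pr1 (ren_pt \<rho> u)"
| "ren_pt \<rho> (App t u) = App (ren_pt \<rho> t) (ren_pt \<rho> u)"
| "ren_pt \<rho> (Lam A u) = Lam A (ren_pt (up_ren \<rho>) u)"
| "ren_pt \<rho> (In0 u) = In0 (ren_pt \<rho> u)"
| "ren_pt \<rho> (In1 u) = In1 (ren_pt \<rho> u)"
| "ren_pt \<rho> (Case u A w1 B w2) =
    Case (ren_pt \<rho> u) A (ren_pt (up_ren \<rho>) w1) B (ren_pt (up_ren \<rho>) w2)"
| "ren_pt \<rho> (IApp u m) = IApp (ren_pt \<rho> u) m"
| "ren_pt \<rho> (ILam u) = ILam (ren_pt \<rho> u)"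
| "ren_pt \<rho> (Wit m u) = Wit m (ren_pt \<rho> u)"
| "ren_pt \<rho> (ExE u A t) = ExE (ren_pt \<rho> u) A (ren_pt (up_ren \<rho>) t)"
| "ren_pt \<rho> (Par A B u v) = Par A B (ren_pt (up_ren \<rho>) u) (ren_pt (up_ren \<rho>) v)"
| "ren_pt \<rho> (Efq P u) = Efq P (ren_pt \<rho> u)"
| "ren_pt \<rho> (PLam t) = PLam (ren_pt \<rho> t)"
| "ren_pt \<rho> (PApp t B) = PApp (ren_pt \<rho> t) B"

text \<open>Renaming of predicate variables.\<close>

primrec pren_pt :: "(nat \<Rightarrow> nat) \<Rightarrow> ('f, 'p) pt \<Rightarrow> ('f, 'p) pt" where
  "pren_pt \<rho> (PV i) = PV i"
| "pren_pt \<rho> (Tup u t) = Tup (pren_pt \<rho> u) (pren_pt \<rho> t)"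
| "pren_pt \<rho> (Pr0 u) = Pr0 (pren_pt \<rho> u)"
| "pren_pt \<rho> (Pr1 u) = Pr1 (pren_pt \<rho> u)"
| "pren_pt \<rho> (App t u) = App (pren_pt \<rho> t) (pren_pt \<rho> u)"
| "pren_pt \<rho> (Lam A u) = Lam (pren_fm \<rho> A) (pren_pt \<rho> u)"
| "pren_pt \<rho> (In0 u) = In0 (pren_pt \<rho> u)"
| "pren_pt \<rho> (In1 u) = In1 (pren_pt \<rho> u)"
| "pren_pt \<rho> (Case u A w1 B w2) =
    Case (pren_pt \<rho> u) (pren_fm \<rho> A) (pren_pt \<rho> w1) (pren_fm \<rho> B) (pren_pt \<rho> w2)"
| "pren_pt \<rho> (IApp u m) = IApp (pren_pt \<rho> u) m"
| "pren_pt \<rho> (ILam u) = ILam (pren_pt \<rho> u)"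
| "pren_pt \<rho> (Wit m u) = Wit m (pren_pt \<rho> u)"
| "pren_pt \<rho> (ExE u A t) = ExE (pren_pt \<rho> u) (pren_fm \<rho> A) (pren_pt \<rho> t)"
| "pren_pt \<rho> (Par A B u v) =
    Par (pren_fm \<rho> A) (pren_fm \<rho> B) (pren_pt \<rho> u) (pren_pt \<rho> v)"
| "pren_pt \<rho> (Efq P u) = Efq (pren_fm \<rho> P) (pren_pt \<rho> u)"
| "pren_pt \<rho> (PLam t) = PLam (pren_pt (up_ren \<rho>) t)"
| "pren_pt \<rho> (PApp t B) = PApp (pren_pt \<rho> t) (pren_fm \<rho> B)"

text \<open>
  The constructor \<open>Efq\<close> is typable at atomic formulas only, but predicate substitution may turn
  its annotation \<open>X(m)\<close> into a compound formula. The term \<open>efq\<^bsub>X(m)\<^esub>(u)\<close> is then sent to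
  the derived ex falso term for the compound formula. As the language need not contain a
  constant, the argument \<open>m\<close> serves as the witness at existential quantifiers:
  \<open>exfalso m A u\<close> is a proof of \<open>A\<close> whenever \<open>u\<close> is a proof of \<open>\<bottom>\<close>, and it is just \<open>Efq A u\<close>
  if \<open>A\<close> is atomic.
\<close>

primrec exfalso :: "'f tm \<Rightarrow> ('f, 'p) fm \<Rightarrow> ('f, 'p) pt \<Rightarrow> ('f, 'p) pt" where
  "exfalso m Bot u = Efq Bot u"
| "exfalso m (Pred p ms) u = Efq (Pred p ms) u"
| "exfalso m (PVar X n) u = Efq (PVar X n) u"
| "exfalso m (And A B) u = Tup (exfalso m A u) (exfalso m B u)"
| "exfalso m (Or A B) u = In0 (exfalso m A u)"
| "exfalso m (Imp A B) u = Lam A (exfalso m B (ren_pt Suc u))"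
| "exfalso m (Uni A) u = ILam (exfalso (subst_tm shift_tm m) A (isubst_pt shift_tm u))"
| "exfalso m (Exi A) u =
    Wit m (isubst_pt (case_nat m Var) (exfalso (subst_tm shift_tm m) A (isubst_pt shift_tm u)))"
| "exfalso m (Uni2 A) u = PLam (exfalso m A (pren_pt Suc u))"

text \<open>Substitution for predicate variables.\<close>

primrec psubst_pt :: "(nat \<Rightarrow> ('f, 'p) fm) \<Rightarrow> ('f, 'p) pt \<Rightarrow> ('f, 'p) pt" where
  "psubst_pt \<theta> (PV i) = PV i"
| "psubst_pt \<theta> (Tup u t) = Tup (psubst_pt \<theta> u) (psubst_pt \<theta> t)"
| "psubst_pt \<theta> (Pr0 u) = Pr0 (psubst_pt \<theta> u)"
| "psubst_pt \<theta> (Pr1 u) = Pr1 (psubst_pt \<theta> u)"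
| "psubst_pt \<theta> (App t u) = App (psubst_pt \<theta> t) (psubst_pt \<theta> u)"
| "psubst_pt \<theta> (Lam A u) = Lam (psubst_fm \<theta> A) (psubst_pt \<theta> u)"
| "psubst_pt \<theta> (In0 u) = In0 (psubst_pt \<theta> u)"
| "psubst_pt \<theta> (In1 u) = In1 (psubst_pt \<theta> u)"
| "psubst_pt \<theta> (Case u A w1 B w2) =
    Case (psubst_pt \<theta> u) (psubst_fm \<theta> A) (psubst_pt \<theta> w1) (psubst_fm \<theta> B) (psubst_pt \<theta> w2)"
| "psubst_pt \<theta> (IApp u m) = IApp (psubst_pt \<theta> u) m"
| "psubst_pt \<theta> (ILam u) = ILam (psubst_pt (ilift_ps \<theta>) u)"
| "psubst_pt \<theta> (Wit m u) = Wit m (psubst_pt \<theta> u)"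
| "psubst_pt \<theta> (ExE u A t) =
    ExE (psubst_pt \<theta> u) (psubst_fm (ilift_ps \<theta>) A) (psubst_pt (ilift_ps \<theta>) t)"
| "psubst_pt \<theta> (Par A B u v) =
    Par (psubst_fm \<theta> A) (psubst_fm \<theta> B) (psubst_pt \<theta> u) (psubst_pt \<theta> v)"
| "psubst_pt \<theta> (Efq P u) =
    (case P of
       PVar X m \<Rightarrow> exfalso m (psubst_fm \<theta> (PVar X m)) (psubst_pt \<theta> u)
     | _ \<Rightarrow> Efq (psubst_fm \<theta> P) (psubst_pt \<theta> u))"
| "psubst_pt \<theta> (PLam t) = PLam (psubst_pt (up_ps \<theta>) t)"
| "psubst_pt \<theta> (PApp t B) = PApp (psubst_pt \<theta> t) (psubst_fm (ilift_ps \<theta>) B)"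

text \<open>Substitution for proof variables.\<close>

definition up_pt :: "(nat \<Rightarrow> ('f, 'p) pt) \<Rightarrow> nat \<Rightarrow> ('f, 'p) pt" where
  "up_pt \<tau> = case_nat (PV 0) (\<lambda>i. ren_pt Suc (\<tau> i))"

primrec subst_pt :: "(nat \<Rightarrow> ('f, 'p) pt) \<Rightarrow> ('f, 'p) pt \<Rightarrow> ('f, 'p) pt" where
  "subst_pt \<tau> (PV i) = \<tau> i"
| "subst_pt \<tau> (Tup u t) = Tup (subst_pt \<tau> u) (subst_pt \<tau> t)"
| "subst_pt \<tau> (Pr0 u) = Pr0 (subst_pt \<tau> u)"
| "subst_pt \<tau> (Pr1 u) = Pr1 (subst_pt \<tau> u)"
| "subst_pt \<tau> (App t u) = App (subst_pt \<tau> t) (subst_pt \<tau> u)"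
| "subst_pt \<tau> (Lam A u) = Lam A (subst_pt (up_pt \<tau>) u)"
| "subst_pt \<tau> (In0 u) = In0 (subst_pt \<tau> u)"
| "subst_pt \<tau> (In1 u) = In1 (subst_pt \<tau> u)"
| "subst_pt \<tau> (Case u A w1 B w2) =
    Case (subst_pt \<tau> u) A (subst_pt (up_pt \<tau>) w1) B (subst_pt (up_pt \<tau>) w2)"
| "subst_pt \<tau> (IApp u m) = IApp (subst_pt \<tau> u) m"
| "subst_pt \<tau> (ILam u) = ILam (subst_pt (\<lambda>i. isubst_pt shift_tm (\<tau> i)) u)"
| "subst_pt \<tau> (Wit m u) = Wit m (subst_pt \<tau> u)"
| "subst_pt \<tau> (ExE u A t) =
    ExE (subst_pt \<tau> u) A (subst_pt (up_pt (\<lambda>i. isubst_pt shift_tm (\<tau> i))) t)"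
| "subst_pt \<tau> (Par A B u v) = Par A B (subst_pt (up_pt \<tau>) u) (subst_pt (up_pt \<tau>) v)"
| "subst_pt \<tau> (Efq P u) = Efq P (subst_pt \<tau> u)"
| "subst_pt \<tau> (PLam t) = PLam (subst_pt (\<lambda>i. pren_pt Suc (\<tau> i)) t)"
| "subst_pt \<tau> (PApp t B) = PApp (subst_pt \<tau> t) B"

text \<open>\<open>t[u/x]\<close>, where \<open>x\<close> is proof index 0 of \<open>t\<close>.\<close>

definition inst_pt :: "('f, 'p) pt \<Rightarrow> ('f, 'p) pt \<Rightarrow> ('f, 'p) pt" where
  "inst_pt u t = subst_pt (case_nat u PV) t"


section \<open>Stacks and basic reductions\<close>

datatype ('f, 'p) stack_elt =
    SArg "('f, 'p) pt"
  | STerm "'f tm"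
  | SPr0
  | SPr1
  | SCase "('f, 'p) fm" "('f, 'p) pt" "('f, 'p) fm" "('f, 'p) pt"
  | SEx "('f, 'p) fm" "('f, 'p) pt"
  | SPred "('f, 'p) fm"

primrec elim :: "('f, 'p) pt \<Rightarrow> ('f, 'p) stack_elt \<Rightarrow> ('f, 'p) pt" where
  "elim t (SArg u) = App t u"
| "elim t (STerm m) = IApp t m"
| "elim t SPr0 = Pr0 t"
| "elim t SPr1 = Pr1 t"
| "elim t (SCase A w1 B w2) = Case t A w1 B w2"
| "elim t (SEx A w) = ExE t A w"
| "elim t (SPred B) = PApp t B"

definition elims :: "('f, 'p) pt \<Rightarrow> ('f, 'p) stack_elt list \<Rightarrow> ('f, 'p) pt" where
  "elims t \<sigma> = foldl elim t \<sigma>"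

primrec ren_stack_elt :: "(nat \<Rightarrow> nat) \<Rightarrow> ('f, 'p) stack_elt \<Rightarrow> ('f, 'p) stack_elt" where
  "ren_stack_elt \<rho> (SArg u) = SArg (ren_pt \<rho> u)"
| "ren_stack_elt \<rho> (STerm m) = STerm m"
| "ren_stack_elt \<rho> SPr0 = SPr0"
| "ren_stack_elt \<rho> SPr1 = SPr1"
| "ren_stack_elt \<rho> (SCase A w1 B w2) = SCase A (ren_pt (up_ren \<rho>) w1) B (ren_pt (up_ren \<rho>) w2)"
| "ren_stack_elt \<rho> (SEx A w) = SEx A (ren_pt (up_ren \<rho>) w)"
| "ren_stack_elt \<rho> (SPred B) = SPred B"

text \<open>
  The basic reductions other than communication. In the permutation rule the shift of \<open>\<xi>\<close> under
  the binder \<open>\<parallel>\<^sub>a\<close> ensures that \<open>a\<close> is not free in it. The rule applies to every kind of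
  stack element: if terms \<open>m\<close> or expressions \<open>(\<lambda>\<alpha> B)\<close> were left out, then for instance
  \<open>(u \<parallel>\<^sub>a v) m\<close> with \<open>u, v : \<forall>\<beta>\<exists>\<alpha> A\<close> would be head normal of existential type without being
  an Herbrand normal form.
\<close>

inductive contracts :: "('f, 'p) pt \<Rightarrow> ('f, 'p) pt \<Rightarrow> bool" where
  beta: "contracts (App (Lam A u) t) (inst_pt t u)"
| ibeta: "contracts (IApp (ILam u) m) (isubst_pt (case_nat m Var) u)"
| pbeta: "contracts (PApp (PLam u) B) (psubst_pt (case_nat B id_ps) u)"
| proj0: "contracts (Pr0 (Tup u0 u1)) u0"
| proj1: "contracts (Pr1 (Tup u0 u1)) u1"
| case0: "contracts (Case (In0 u) A t0 B t1) (inst_pt u t0)"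
| case1: "contracts (Case (In1 u) A t0 B t1) (inst_pt u t1)"
| exE: "contracts (ExE (Wit m u) A v) (inst_pt u (isubst_pt (case_nat m Var) v))"
| perm: "contracts (elim (Par A B u v) \<xi>)
    (Par A B (elim u (ren_stack_elt Suc \<xi>)) (elim v (ren_stack_elt Suc \<xi>)))"


section \<open>Head reduction\<close>

datatype ('f, 'p) par_ctxt =
    Hole
  | ParL "('f, 'p) fm" "('f, 'p) fm" "('f, 'p) par_ctxt" "('f, 'p) pt"
  | ParR "('f, 'p) fm" "('f, 'p) fm" "('f, 'p) pt" "('f, 'p) par_ctxt"

text \<open>\<open>\<C>[u]\<close>; variables of \<open>u\<close> may be captured by the binders \<open>\<parallel>\<^sub>a\<close> above the hole.\<close>

primrec plug :: "('f, 'p) par_ctxt \<Rightarrow> ('f, 'p) pt \<Rightarrow> ('f, 'p) pt" where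
  "plug Hole u = u"
| "plug (ParL A B C v) u = Par A B (plug C u) v"
| "plug (ParR A B w C) u = Par A B w (plug C u)"

text \<open>The number of proof variable binders above the hole.\<close>

primrec depth :: "('f, 'p) par_ctxt \<Rightarrow> nat" where
  "depth Hole = 0"
| "depth (ParL A B C v) = Suc (depth C)"
| "depth (ParR A B w C) = Suc (depth C)"

text \<open>The elementary processes of a term, from left to right.\<close>

fun elem_procs :: "('f, 'p) pt \<Rightarrow> ('f, 'p) pt list" where
  "elem_procs (Par A B u v) = elem_procs u @ elem_procs v"
| "elem_procs t = [t]"

text \<open>The number of elementary processes to the left of the hole.\<close>

primrec hole_pos :: "('f, 'p) par_ctxt \<Rightarrow> nat" where
  "hole_pos Hole = 0"
| "hole_pos (ParL A B C v) = hole_pos C"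
| "hole_pos (ParR A B w C) = length (elem_procs w) + hole_pos C"

text \<open>
  The substitution \<open>[\<lambda>y\<^sup>B u/a]\<close> applied to the partner process \<open>v\<close> of \<open>\<C>[a u \<sigma>]\<close> as it is moved
  into the hole of \<open>\<C>\<close>, where \<open>n\<close> is the depth of \<open>\<C>\<close>: index 0 of \<open>v\<close> is \<open>a\<close>, while its index
  \<open>Suc k\<close> is seen as \<open>Suc k + n\<close> from inside \<open>\<C>\<close>. The message \<open>u\<close> already lives inside \<open>\<C>\<close>, and
  \<open>y\<close> is dummy.
\<close>

definition comm_subst :: "('f, 'p) fm \<Rightarrow> ('f, 'p) pt \<Rightarrow> nat \<Rightarrow> nat \<Rightarrow> ('f, 'p) pt" where
  "comm_subst B u n = case_nat (Lam B (ren_pt Suc u)) (\<lambda>k. PV (Suc k + n))"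

text \<open>
  \<open>head_contr t i t'\<close>: \<open>t'\<close> is obtained from \<open>t\<close> by contracting the head redex of a parallel
  process of \<open>t\<close>, with starting symbol in the \<open>i\<close>-th elementary process of \<open>t\<close>. An elementary
  process contains at most one starting symbol: the opening parenthesis of \<open>r\<xi>\<close> if it is of the
  form \<open>r\<xi>\<sigma>\<close>, the channel \<open>a\<close> if it is of the form \<open>a s \<rho>\<close>. In the latter case the head redex
  is the parallel process that binds \<open>a\<close>, which is located by \<open>D\<close>; the variable \<open>a\<close> is the index
  \<open>depth C\<close> inside \<open>C\<close>.
\<close>

inductive head_contr :: "('f, 'p) pt \<Rightarrow> nat \<Rightarrow> ('f, 'p) pt \<Rightarrow> bool" where
  elementary: "contracts h h' \<Longrightarrow>
    head_contr (plug D (elims h \<sigma>)) (hole_pos D) (plug D (elims h' \<sigma>))"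
| comm_left: "head_contr
    (plug D (Par A B (plug C (elims (App (PV (depth C)) s) \<rho>)) v))
    (hole_pos D + hole_pos C)
    (plug D (Par A B (plug C (subst_pt (comm_subst B s (depth C)) v)) v))"
| comm_right: "head_contr
    (plug D (Par A B v (plug C (elims (App (PV (depth C)) s) \<rho>))))
    (hole_pos D + length (elem_procs v) + hole_pos C)
    (plug D (Par A B v (plug C (subst_pt (comm_subst A s (depth C)) v))))"

definition head_red :: "('f, 'p) pt \<Rightarrow> ('f, 'p) pt \<Rightarrow> bool"  (infix "\<succ>" 50) where
  "t \<succ> t' \<longleftrightarrow> (\<exists>i. head_contr t i t' \<and> (\<forall>j<i. \<nexists>t''. head_contr t j t''))"

definition head_normal :: "('f, 'p) pt \<Rightarrow> bool" where
  "head_normal u \<longleftrightarrow> (\<nexists>u'. u \<succ> u')"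


section \<open>Herbrand normal forms\<close>

inductive herbrand_nf :: "('f, 'p) pt \<Rightarrow> bool" where
  "herbrand_nf (Wit m u)"
| "herbrand_nf u \<Longrightarrow> herbrand_nf v \<Longrightarrow> herbrand_nf (Par A B u v)"

text \<open>\<open>disjunction A [B\<^sub>1, \<dots>, B\<^sub>k]\<close> is \<open>A \<or> B\<^sub>1 \<or> \<dots> \<or> B\<^sub>k\<close>, associated to the right.\<close>

primrec disjunction :: "('f, 'p) fm \<Rightarrow> ('f, 'p) fm list \<Rightarrow> ('f, 'p) fm" where
  "disjunction A [] = A"
| "disjunction A (B # Bs) = Or A (disjunction B Bs)"

end

theory Submission
  imports Defs
begin

text \<open>
  Termination is a matter of untyped terms. Erase all formulas and individual terms, and erase
  \<open>efq\<^bsub>P\<^esub>(u)\<close> to a constant that absorbs every elimination; the shape of the derived ex falso terms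
  then no longer matters. Erased terms are normalized by Krivine-style realizability, made
  Kripke-like: the worlds are the lists of partner processes around the hole of a parallel
  context, and candidates are sets of stacks that grow along extensions of the context. For
  \<open>u \<parallel>\<^sub>a v\<close> against a stack \<open>\<sigma>\<close>, the variable \<open>a\<close> realizes \<open>A \<rightarrow> B\<close> in the world extended by
  \<open>v\<sigma>\<close>: when it meets a realizer \<open>s\<close> of \<open>A\<close>, the process becomes \<open>v[\<lambda>y s/a]\<sigma>\<close>, where \<open>\<lambda>y s\<close>
  realizes \<open>B \<rightarrow> A\<close>. Hence \<open>u\<sigma>\<close> evaluates to values \<open>U\<close>; then \<open>v\<sigma>\<close> is evaluated next to \<open>U\<close>, and
  a message sent to \<open>U\<close> yields values again, since substitution maps values to values.
  Subject reduction guarantees that each erased step comes from a head reduction step of the typed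
  term and that the final values are pairs \<open>(m, v)\<close>.
\<close>

section \<open>Erased terms\<close>

text \<open>\<open>UBox\<close> and \<open>UUnbox\<close> serve both universal quantifiers, as
  \<open>UIn0\<close> and \<open>UCase\<close> also serve the existential one. Boxes are kept so
  that every erased step matches exactly one head reduction step.\<close>

datatype utm =
    UV nat
  | UTup utm utm
  | UPr0 utm
  | UPr1 utm
  | UApp utm utm
  | ULam utm
  | UIn0 utm
  | UIn1 utm
  | UCase utm utm utm
  | UBox utm
  | UUnbox utm
  | UPar utm utm
  | UAbort

primrec uren :: "(nat \<Rightarrow> nat) \<Rightarrow> utm \<Rightarrow> utm" where
  "uren \<rho> (UV i) = UV (\<rho> i)"
| "uren \<rho> (UTup u v) = UTup (uren \<rho> u) (uren \<rho> v)"
| "uren \<rho> (UPr0 u) = UPr0 (uren \<rho> u)"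
| "uren \<rho> (UPr1 u) = UPr1 (uren \<rho> u)"
| "uren \<rho> (UApp u v) = UApp (uren \<rho> u) (uren \<rho> v)"
| "uren \<rho> (ULam u) = ULam (uren (up_ren \<rho>) u)"
| "uren \<rho> (UIn0 u) = UIn0 (uren \<rho> u)"
| "uren \<rho> (UIn1 u) = UIn1 (uren \<rho> u)"
| "uren \<rho> (UCase u v w) = UCase (uren \<rho> u) (uren (up_ren \<rho>) v) (uren (up_ren \<rho>) w)"
| "uren \<rho> (UBox u) = UBox (uren \<rho> u)"
| "uren \<rho> (UUnbox u) = UUnbox (uren \<rho> u)"
| "uren \<rho> (UPar u v) = UPar (uren (up_ren \<rho>) u) (uren (up_ren \<rho>) v)"
| "uren \<rho> UAbort = UAbort"

definition uup :: "(nat \<Rightarrow> utm) \<Rightarrow> nat \<Rightarrow> utm" where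
  "uup \<tau> = case_nat (UV 0) (\<lambda>i. uren Suc (\<tau> i))"

primrec usubst :: "(nat \<Rightarrow> utm) \<Rightarrow> utm \<Rightarrow> utm" where
  "usubst \<tau> (UV i) = \<tau> i"
| "usubst \<tau> (UTup u v) = UTup (usubst \<tau> u) (usubst \<tau> v)"
| "usubst \<tau> (UPr0 u) = UPr0 (usubst \<tau> u)"
| "usubst \<tau> (UPr1 u) = UPr1 (usubst \<tau> u)"
| "usubst \<tau> (UApp u v) = UApp (usubst \<tau> u) (usubst \<tau> v)"
| "usubst \<tau> (ULam u) = ULam (usubst (uup \<tau>) u)"
| "usubst \<tau> (UIn0 u) = UIn0 (usubst \<tau> u)"
| "usubst \<tau> (UIn1 u) = UIn1 (usubst \<tau> u)"
| "usubst \<tau> (UCase u v w) = UCase (usubst \<tau> u) (usubst (uup \<tau>) v) (usubst (uup \<tau>) w)"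
| "usubst \<tau> (UBox u) = UBox (usubst \<tau> u)"
| "usubst \<tau> (UUnbox u) = UUnbox (usubst \<tau> u)"
| "usubst \<tau> (UPar u v) = UPar (usubst (uup \<tau>) u) (usubst (uup \<tau>) v)"
| "usubst \<tau> UAbort = UAbort"

section \<open>Composition laws for renaming and substitution of erased terms\<close>

lemma up_ren_simps [simp]: "up_ren \<rho> 0 = 0" "up_ren \<rho> (Suc n) = Suc (\<rho> n)"
  by (simp_all add: up_ren_def)

lemma uup_simps [simp]: "uup \<tau> 0 = UV 0" "uup \<tau> (Suc n) = uren Suc (\<tau> n)"
  by (simp_all add: uup_def)

lemma up_ren_comp [simp]: "(\<lambda>i. up_ren \<rho> (up_ren \<rho>' i)) = up_ren (\<lambda>i. \<rho> (\<rho>' i))"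
  by (auto simp: fun_eq_iff up_ren_def split: nat.split)

lemma up_ren_id [simp]: "up_ren (\<lambda>i. i) = (\<lambda>i. i)"
  by (auto simp: fun_eq_iff up_ren_def split: nat.split)

lemma uren_uren [simp]: "uren \<rho> (uren \<rho>' t) = uren (\<lambda>i. \<rho> (\<rho>' i)) t"
  by (induction t arbitrary: \<rho> \<rho>') simp_all

lemma uren_id [simp]: "uren (\<lambda>i. i) t = t"
  by (induction t) simp_all

lemma uup_up_ren: "(\<lambda>i. uup \<tau> (up_ren \<rho> i)) = uup (\<lambda>i. \<tau> (\<rho> i))"
  by (auto simp: fun_eq_iff uup_def up_ren_def split: nat.split)

lemma usubst_uren [simp]: "usubst \<tau> (uren \<rho> t) = usubst (\<lambda>i. \<tau> (\<rho> i)) t"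
  by (induction t arbitrary: \<tau> \<rho>) (simp_all add: uup_up_ren)

lemma uren_uup: "(\<lambda>i. uren (up_ren \<rho>) (uup \<tau> i)) = uup (\<lambda>i. uren \<rho> (\<tau> i))"
  by (auto simp: fun_eq_iff uup_def split: nat.split)

lemma uren_usubst [simp]: "uren \<rho> (usubst \<tau> t) = usubst (\<lambda>i. uren \<rho> (\<tau> i)) t"
  by (induction t arbitrary: \<tau> \<rho>) (simp_all add: uren_uup)

lemma usubst_uup: "(\<lambda>i. usubst (uup \<tau>) (uup \<tau>' i)) = uup (\<lambda>i. usubst \<tau> (\<tau>' i))"
  by (auto simp: fun_eq_iff uup_def split: nat.split)

lemma usubst_usubst [simp]: "usubst \<tau> (usubst \<tau>' t) = usubst (\<lambda>i. usubst \<tau> (\<tau>' i)) t"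
  by (induction t arbitrary: \<tau> \<tau>') (simp_all add: usubst_uup)

lemma uup_id [simp]: "uup UV = UV"
  by (auto simp: fun_eq_iff uup_def split: nat.split)

lemma usubst_id [simp]: "usubst UV t = t"
  by (induction t) simp_all

definition uinst :: "utm \<Rightarrow> utm \<Rightarrow> utm" where
  "uinst u t = usubst (case_nat u UV) t"

section \<open>Erased stacks and evaluation\<close>

datatype ustk = KArg utm | KUnbox | KPr0 | KPr1 | KCase utm utm

primrec uelim :: "utm \<Rightarrow> ustk \<Rightarrow> utm" where
  "uelim t (KArg u) = UApp t u"
| "uelim t KUnbox = UUnbox t"
| "uelim t KPr0 = UPr0 t"
| "uelim t KPr1 = UPr1 t"
| "uelim t (KCase v w) = UCase t v w"

definition uelims :: "utm \<Rightarrow> ustk list \<Rightarrow> utm" where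
  "uelims t \<sigma> = foldl uelim t \<sigma>"

lemma uelims_simps [simp]: "uelims t [] = t" "uelims t (\<xi> # \<sigma>) = uelims (uelim t \<xi>) \<sigma>"
  by (simp_all add: uelims_def)

primrec kren :: "(nat \<Rightarrow> nat) \<Rightarrow> ustk \<Rightarrow> ustk" where
  "kren \<rho> (KArg u) = KArg (uren \<rho> u)"
| "kren \<rho> KUnbox = KUnbox"
| "kren \<rho> KPr0 = KPr0"
| "kren \<rho> KPr1 = KPr1"
| "kren \<rho> (KCase v w) = KCase (uren (up_ren \<rho>) v) (uren (up_ren \<rho>) w)"

primrec ksubst :: "(nat \<Rightarrow> utm) \<Rightarrow> ustk \<Rightarrow> ustk" where
  "ksubst \<tau> (KArg u) = KArg (usubst \<tau> u)"
| "ksubst \<tau> KUnbox = KUnbox"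
| "ksubst \<tau> KPr0 = KPr0"
| "ksubst \<tau> KPr1 = KPr1"
| "ksubst \<tau> (KCase v w) = KCase (usubst (uup \<tau>) v) (usubst (uup \<tau>) w)"

lemma kren_kren [simp]: "kren \<rho> (kren \<rho>' \<xi>) = kren (\<lambda>i. \<rho> (\<rho>' i)) \<xi>"
  by (cases \<xi>) simp_all

lemma kren_id [simp]: "kren (\<lambda>i. i) \<xi> = \<xi>"
  by (cases \<xi>) simp_all

lemma uup_var: "uup (\<lambda>i. UV (\<rho> i)) = (\<lambda>i. UV (up_ren \<rho> i))"
  by (auto simp: fun_eq_iff uup_def up_ren_def split: nat.split)

lemma usubst_var: "usubst (\<lambda>i. UV (\<rho> i)) t = uren \<rho> t"
  by (induction t arbitrary: \<rho>) (simp_all add: uup_var)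

lemma ksubst_kren: "ksubst \<tau> (kren \<rho> \<xi>) = ksubst (\<lambda>i. \<tau> (\<rho> i)) \<xi>"
  by (cases \<xi>) (simp_all add: uup_up_ren)

lemma ksubst_var: "ksubst (\<lambda>i. UV (\<rho> i)) \<xi> = kren \<rho> \<xi>"
  by (cases \<xi>) (simp_all add: uup_var usubst_var)

lemma usubst_uelims: "usubst \<tau> (uelims t \<sigma>) = uelims (usubst \<tau> t) (map (ksubst \<tau>) \<sigma>)"
proof (induction \<sigma> arbitrary: t)
  case (Cons \<xi> \<sigma>)
  then show ?case by (cases \<xi>) simp_all
qed simp

text \<open>The abort rules mirror the reductions of derived ex falso terms: at compound types these
  are introductions, and an elimination exposes another such term. \<open>abort_case\<close> takes
  the first branch because \<open>exfalso\<close> proves a disjunction by \<open>In0\<close>; for an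
  existential formula both erased branches coincide.\<close>

inductive ured :: "utm \<Rightarrow> utm \<Rightarrow> bool" where
  beta: "ured (UApp (ULam u) t) (uinst t u)"
| box: "ured (UUnbox (UBox u)) u"
| proj0: "ured (UPr0 (UTup u v)) u"
| proj1: "ured (UPr1 (UTup u v)) v"
| case0: "ured (UCase (UIn0 u) v w) (uinst u v)"
| case1: "ured (UCase (UIn1 u) v w) (uinst u w)"
| perm: "ured (uelim (UPar u v) \<xi>) (UPar (uelim u (kren Suc \<xi>)) (uelim v (kren Suc \<xi>)))"
| abort_app: "ured (UApp UAbort t) UAbort"
| abort_unbox: "ured (UUnbox UAbort) UAbort"
| abort_pr0: "ured (UPr0 UAbort) UAbort"
| abort_pr1: "ured (UPr1 UAbort) UAbort"
| abort_case: "ured (UCase UAbort v w) (uinst UAbort v)"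

definition ucomm :: "utm \<Rightarrow> nat \<Rightarrow> nat \<Rightarrow> utm" where
  "ucomm s n = case_nat (ULam (uren Suc s)) (\<lambda>k. UV (Suc k + n))"

text \<open>\<open>ev F t U\<close>: below the binders of parallel operators whose other processes are \<open>F\<close>,
  innermost first, head reduction turns \<open>t\<close> into the parallel composition \<open>U\<close> of values.\<close>

inductive ev :: "utm list \<Rightarrow> utm \<Rightarrow> utm \<Rightarrow> bool" where
  value_in: "ev F (UIn0 t) (UIn0 t)"
| value_abort: "ev F UAbort UAbort"
| step: "ured h h' \<Longrightarrow> ev F (uelims h' \<sigma>) U \<Longrightarrow> ev F (uelims h \<sigma>) U"
| comm: "n < length F \<Longrightarrow> ev F (usubst (ucomm s n) (F ! n)) U
    \<Longrightarrow> ev F (uelims (UApp (UV n) s) \<sigma>) U"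
| par: "ev (v # F) u U \<Longrightarrow> ev (U # F) v V \<Longrightarrow> ev F (UPar u v) (UPar U V)"

text \<open>\<open>UIn1\<close> is absent: only terms of existential type are evaluated, and pairs
  erase to \<open>UIn0\<close>.\<close>

inductive uvalues :: "utm \<Rightarrow> bool" where
  "uvalues (UIn0 t)"
| "uvalues UAbort"
| "uvalues U \<Longrightarrow> uvalues V \<Longrightarrow> uvalues (UPar U V)"

lemma ev_uvalues: "ev F t U \<Longrightarrow> uvalues U"
  by (induction rule: ev.induct) (auto intro: uvalues.intros)

lemma uvalues_ev: "uvalues U \<Longrightarrow> ev F U U"
  by (induction arbitrary: F rule: uvalues.induct) (auto intro: ev.intros)

text \<open>Substitution acts strictly inside the injections. Hence a message sent to an evaluated
  partner produces values at once.\<close>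

lemma uvalues_usubst: "uvalues U \<Longrightarrow> uvalues (usubst \<tau> U)"
  by (induction arbitrary: \<tau> rule: uvalues.induct) (auto intro: uvalues.intros)

section \<open>Realizability\<close>

text \<open>The argument is the world, the list of partner processes that \<open>ev\<close>
  carries.\<close>

type_synonym cand = "utm list \<Rightarrow> ustk list set"

definition pole :: "utm list \<Rightarrow> utm \<Rightarrow> bool" where
  "pole F t \<longleftrightarrow> (\<exists>U. ev F t U)"

abbreviation ush :: "nat \<Rightarrow> utm \<Rightarrow> utm" where
  "ush n \<equiv> uren (\<lambda>i. i + n)"

abbreviation ksh :: "nat \<Rightarrow> ustk list \<Rightarrow> ustk list" where
  "ksh n \<equiv> map (kren (\<lambda>i. i + n))"

lemma pole_red: "ured h h' \<Longrightarrow> pole F (uelims h' \<sigma>) \<Longrightarrow> pole F (uelims h \<sigma>)"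
  by (auto simp: pole_def intro: ev.step)

lemma pole_uvalues: "uvalues U \<Longrightarrow> pole F U"
  by (auto simp: pole_def intro: uvalues_ev)

lemma pole_perm:
  "pole F (UPar (uelims u (map (kren Suc) \<sigma>)) (uelims v (map (kren Suc) \<sigma>)))
    \<Longrightarrow> pole F (uelims (UPar u v) \<sigma>)"
proof (induction \<sigma> arbitrary: u v)
  case (Cons \<xi> \<sigma>)
  then show ?case by (auto intro: pole_red ured.perm)
qed simp

text \<open>The orthogonal of \<open>R\<close> with respect to the pole. Quantifying over extensions
  \<open>E\<close>, with the shift past the new channels, builds in Kripke monotonicity.\<close>

definition rlz :: "cand \<Rightarrow> utm list \<Rightarrow> utm set" where
  "rlz R F = {t. \<forall>E. \<forall>\<sigma>\<in>R (E @ F). pole (E @ F) (uelims (ush (length E) t) \<sigma>)}"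

text \<open>A reducibility candidate stated for stacks: the first clause makes \<open>UAbort\<close>
  a realizer in every world, the second lets stacks follow an extension of the context.\<close>

definition candidate :: "cand \<Rightarrow> bool" where
  "candidate R \<longleftrightarrow> (\<forall>F. \<forall>\<sigma>\<in>R F. pole F (uelims UAbort \<sigma>) \<and> (\<forall>E. ksh (length E) \<sigma> \<in> R (E @ F)))"

text \<open>Individual terms are ignored. \<open>And\<close>, \<open>Imp\<close> and the universal
  quantifiers are given by their eliminations, \<open>Or\<close> and \<open>Exi\<close> by
  orthogonality to their introductions, where the condition on \<open>UAbort\<close> ensures that
  candidates result. \<open>Bot\<close> and \<open>Pred\<close> have no stacks, so every erased term
  realizes them. \<open>Uni2\<close> ranges over all candidates, which is the impredicative
  clause.\<close>

primrec stacks :: "('f, 'p) fm \<Rightarrow> (nat \<Rightarrow> cand) \<Rightarrow> cand" where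
  "stacks Bot \<xi> = (\<lambda>F. {})"
| "stacks (Pred p ms) \<xi> = (\<lambda>F. {})"
| "stacks (PVar X m) \<xi> = \<xi> X"
| "stacks (And A B) \<xi> = (\<lambda>F. (#) KPr0 ` stacks A \<xi> F \<union> (#) KPr1 ` stacks B \<xi> F)"
| "stacks (Or A B) \<xi> = (\<lambda>F. {\<sigma>. \<forall>E.
      (\<forall>s\<in>rlz (stacks A \<xi>) (E @ F). pole (E @ F) (uelims (UIn0 s) (ksh (length E) \<sigma>))) \<and>
      (\<forall>s\<in>rlz (stacks B \<xi>) (E @ F). pole (E @ F) (uelims (UIn1 s) (ksh (length E) \<sigma>))) \<and>
      pole (E @ F) (uelims UAbort (ksh (length E) \<sigma>))})"
| "stacks (Imp A B) \<xi> = (\<lambda>F. {KArg s # \<sigma> |s \<sigma>. s \<in> rlz (stacks A \<xi>) F \<and> \<sigma> \<in> stacks B \<xi> F})"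
| "stacks (Uni A) \<xi> = (\<lambda>F. (#) KUnbox ` stacks A \<xi> F)"
| "stacks (Exi A) \<xi> = (\<lambda>F. {\<sigma>. \<forall>E.
      (\<forall>s\<in>rlz (stacks A \<xi>) (E @ F). pole (E @ F) (uelims (UIn0 s) (ksh (length E) \<sigma>))) \<and>
      pole (E @ F) (uelims UAbort (ksh (length E) \<sigma>))})"
| "stacks (Uni2 A) \<xi> =
    (\<lambda>F. {KUnbox # \<sigma> |R \<sigma>. candidate R \<and> \<sigma> \<in> stacks A (case_nat R \<xi>) F})"

section \<open>Kripke monotonicity of realizers and candidates\<close>

lemma rlzI:
  "(\<And>E \<sigma>. \<sigma> \<in> R (E @ F) \<Longrightarrow> pole (E @ F) (uelims (ush (length E) t) \<sigma>)) \<Longrightarrow> t \<in> rlz R F"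
  by (simp add: rlz_def)

lemma rlzD:
  "t \<in> rlz R F \<Longrightarrow> \<sigma> \<in> R (E @ F) \<Longrightarrow> pole (E @ F) (uelims (ush (length E) t) \<sigma>)"
  by (simp add: rlz_def)

lemma rlz_pole: "t \<in> rlz R F \<Longrightarrow> \<sigma> \<in> R F \<Longrightarrow> pole F (uelims t \<sigma>)"
  using rlzD[of t R F \<sigma> "[]"] by simp

lemma rlz_mono:
  assumes "t \<in> rlz R F"
  shows "ush (length E) t \<in> rlz R (E @ F)"
proof (rule rlzI)
  fix E' \<sigma> assume "\<sigma> \<in> R (E' @ E @ F)"
  then show "pole (E' @ E @ F) (uelims (ush (length E') (ush (length E) t)) \<sigma>)"
    using rlzD[OF assms, of \<sigma> "E' @ E"] by (simp add: ac_simps)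
qed

lemma candidate_abort: "candidate R \<Longrightarrow> UAbort \<in> rlz R F"
  by (rule rlzI) (simp add: candidate_def)

lemma candidate_mono: "candidate R \<Longrightarrow> \<sigma> \<in> R F \<Longrightarrow> ksh (length E) \<sigma> \<in> R (E @ F)"
  by (simp add: candidate_def)

lemma candidate_pole: "candidate R \<Longrightarrow> \<sigma> \<in> R F \<Longrightarrow> pole F (uelims UAbort \<sigma>)"
  by (simp add: candidate_def)

lemma candidateI:
  "(\<And>F \<sigma>. \<sigma> \<in> R F \<Longrightarrow> pole F (uelims UAbort \<sigma>)) \<Longrightarrow>
   (\<And>F E \<sigma>. \<sigma> \<in> R F \<Longrightarrow> ksh (length E) \<sigma> \<in> R (E @ F)) \<Longrightarrow> candidate R"
  by (auto simp: candidate_def)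

lemma candidate_case_nat: "candidate R \<Longrightarrow> \<forall>X. candidate (\<xi> X) \<Longrightarrow> \<forall>X. candidate (case_nat R \<xi> X)"
  by (auto split: nat.split)

lemma map_kren_id [simp]: "map (kren (\<lambda>i. i)) \<sigma> = \<sigma>"
  by (simp add: map_idI)

lemma ksh_0: "ksh 0 \<sigma> = \<sigma>"
  by (simp add: map_idI)

lemma ksh_ksh: "ksh m (ksh n \<sigma>) = ksh (m + n) \<sigma>"
  by (simp add: ac_simps)

text \<open>At the connectives given by eliminations, an abort rule strips the first stack element
  and leaves \<open>UAbort\<close> against a stack of a subformula. This lemma makes
  \<open>stacks B \<xi>\<close> an admissible value for a predicate variable in the rule
  \<open>PApp\<close>.\<close>

lemma candidate_stacks: "\<forall>X. candidate (\<xi> X) \<Longrightarrow> candidate (stacks A \<xi>)"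
proof (induction A arbitrary: \<xi>)
  case (And A B)
  then have "candidate (stacks A \<xi>)" "candidate (stacks B \<xi>)" by auto
  note * = this[THEN candidate_pole] this[THEN candidate_mono]
  show ?case
    by (intro candidateI)
      (auto simp del: map_map intro: *(3,4)
        pole_red[OF ured.abort_pr0 *(1)] pole_red[OF ured.abort_pr1 *(2)])
next
  case (Or A B)
  have "pole F (uelims UAbort \<sigma>)" if "\<sigma> \<in> stacks (Or A B) \<xi> F" for F \<sigma>
    using that by (auto simp: ksh_0 dest!: spec[of _ "[]"])
  \<comment> \<open>An extension of \<open>E @ F\<close> is an extension of \<open>F\<close>, so the
    condition at \<open>F\<close> is used for lists of the form \<open>_ @ E\<close>, and the two
    shifts add up.\<close>
  moreover have "ksh (length E) \<sigma> \<in> stacks (Or A B) \<xi> (E @ F)"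
    if "\<sigma> \<in> stacks (Or A B) \<xi> F" for F E \<sigma>
    unfolding stacks.simps mem_Collect_eq
    by (rule allI, use that[unfolded stacks.simps mem_Collect_eq, THEN spec, of "_ @ E"]
        in \<open>simp add: ksh_ksh del: map_map\<close>)
  ultimately show ?case by (rule candidateI)
next
  case (Imp A B)
  then have "candidate (stacks A \<xi>)" "candidate (stacks B \<xi>)" by auto
  note * = this[THEN candidate_pole] this[THEN candidate_mono]
  show ?case
    by (intro candidateI)
      (auto simp del: map_map intro: pole_red[OF ured.abort_app *(2)] rlz_mono *)
next
  case (Uni A)
  then have "candidate (stacks A \<xi>)" by auto
  note * = this[THEN candidate_pole] this[THEN candidate_mono]
  show ?case
    by (intro candidateI) (auto simp del: map_map intro: pole_red[OF ured.abort_unbox *(1)] *(2))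
next
  case (Exi A)
  have "pole F (uelims UAbort \<sigma>)" if "\<sigma> \<in> stacks (Exi A) \<xi> F" for F \<sigma>
    using that by (auto simp: ksh_0 dest!: spec[of _ "[]"])
  moreover have "ksh (length E) \<sigma> \<in> stacks (Exi A) \<xi> (E @ F)"
    if "\<sigma> \<in> stacks (Exi A) \<xi> F" for F E \<sigma>
    unfolding stacks.simps mem_Collect_eq
    by (rule allI, use that[unfolded stacks.simps mem_Collect_eq, THEN spec, of "_ @ E"]
        in \<open>simp add: ksh_ksh del: map_map\<close>)
  ultimately show ?case by (rule candidateI)
next
  case (Uni2 A)
  then have *: "candidate (stacks A (case_nat R \<xi>))" if "candidate R" for R
    using candidate_case_nat that by blast
  have "pole F (uelims UAbort \<sigma>)" if "\<sigma> \<in> stacks (Uni2 A) \<xi> F" for F \<sigma>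
    using that by (auto intro: pole_red[OF ured.abort_unbox candidate_pole[OF *]])
  moreover have "ksh (length E) \<sigma> \<in> stacks (Uni2 A) \<xi> (E @ F)"
    if "\<sigma> \<in> stacks (Uni2 A) \<xi> F" for F E \<sigma>
  proof -
    from that obtain R \<sigma>' where "\<sigma> = KUnbox # \<sigma>'" "candidate R" "\<sigma>' \<in> stacks A (case_nat R \<xi>) F"
      by auto
    with candidate_mono[OF *] show ?thesis by (force simp del: map_map)
  qed
  ultimately show ?case by (rule candidateI)
qed (auto intro: candidateI)

section \<open>Substitution lemmas for the interpretation of formulas\<close>

lemma stacks_isubst [simp]: "stacks (isubst_fm \<sigma> A) \<xi> = stacks A \<xi>"
  by (induction A arbitrary: \<sigma> \<xi>) simp_all

lemma stacks_pren: "stacks (pren_fm \<rho> A) \<xi> = stacks A (\<lambda>X. \<xi> (\<rho> X))"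
proof (induction A arbitrary: \<rho> \<xi>)
  case (Uni2 A)
  have "(\<lambda>X. case_nat R \<xi> (up_ren \<rho> X)) = case_nat R (\<lambda>X. \<xi> (\<rho> X))" for R :: cand
    by (auto simp: fun_eq_iff split: nat.split)
  then show ?case by (simp add: Uni2)
qed simp_all

text \<open>Predicate substitution becomes a change of valuation. The argument of a predicate
  variable leaves no trace, since stacks ignore individual terms.\<close>

lemma stacks_psubst: "stacks (psubst_fm \<theta> A) \<xi> = stacks A (\<lambda>X. stacks (\<theta> X) \<xi>)"
proof (induction A arbitrary: \<theta> \<xi>)
  case (Uni2 A)
  have "(\<lambda>X. stacks (up_ps \<theta> X) (case_nat R \<xi>)) = case_nat R (\<lambda>X. stacks (\<theta> X) \<xi>)" for R :: cand
    by (auto simp: fun_eq_iff up_ps_def id_ps_def stacks_pren split: nat.split)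
  then show ?case by (simp add: Uni2)
qed (simp_all add: inst_fm_def ilift_ps_def)

lemma stacks_inst [simp]: "stacks (inst_fm m A) \<xi> = stacks A \<xi>"
  by (simp add: inst_fm_def)

lemma stacks_pinst: "stacks (pinst_fm B A) \<xi> = stacks A (case_nat (stacks B \<xi>) \<xi>)"
proof -
  have "(\<lambda>X. stacks (case_nat B id_ps X) \<xi>) = case_nat (stacks B \<xi>) \<xi>"
    by (auto simp: fun_eq_iff id_ps_def split: nat.split)
  then show ?thesis by (simp add: pinst_fm_def stacks_psubst)
qed

section \<open>Adequacy\<close>

text \<open>The witness of a pair is dropped, and \<open>ExE\<close> becomes a case distinction with
  twice the same branch. \<open>Efq\<close> loses its argument, which no reduction ever has to
  evaluate.\<close>

primrec er :: "('f, 'p) pt \<Rightarrow> utm" where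
  "er (PV i) = UV i"
| "er (Tup u t) = UTup (er u) (er t)"
| "er (Pr0 u) = UPr0 (er u)"
| "er (Pr1 u) = UPr1 (er u)"
| "er (App t u) = UApp (er t) (er u)"
| "er (Lam A u) = ULam (er u)"
| "er (In0 u) = UIn0 (er u)"
| "er (In1 u) = UIn1 (er u)"
| "er (Case u A w1 B w2) = UCase (er u) (er w1) (er w2)"
| "er (IApp u m) = UUnbox (er u)"
| "er (ILam u) = UBox (er u)"
| "er (Wit m u) = UIn0 (er u)"
| "er (ExE u A t) = UCase (er u) (er t) (er t)"
| "er (Par A B u v) = UPar (er u) (er v)"
| "er (Efq P u) = UAbort"
| "er (PLam t) = UBox (er t)"
| "er (PApp t B) = UUnbox (er t)"

text \<open>Turns the extended environment of an induction hypothesis into the contractum of a beta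
  or case step.\<close>

lemma usubst_uinst: "usubst (case_nat s \<tau>) t = uinst s (usubst (uup \<tau>) t)"
proof -
  have "(\<lambda>i. usubst (case_nat s UV) (uup \<tau> i)) = case_nat s \<tau>"
    by (auto simp: fun_eq_iff uup_def split: nat.split)
  then show ?thesis by (simp add: uinst_def)
qed

section \<open>Realizability of environments and of the individual proof rules\<close>

definition realizes_env :: "(nat \<Rightarrow> cand) \<Rightarrow> utm list \<Rightarrow> (nat \<Rightarrow> utm) \<Rightarrow> ('f, 'p) fm list \<Rightarrow> bool" where
  "realizes_env \<xi> F \<tau> \<Gamma> \<longleftrightarrow> (\<forall>i<length \<Gamma>. \<tau> i \<in> rlz (stacks (\<Gamma> ! i) \<xi>) F)"

lemma realizes_env_mono:
  "realizes_env \<xi> F \<tau> \<Gamma> \<Longrightarrow> realizes_env \<xi> (E @ F) (\<lambda>i. ush (length E) (\<tau> i)) \<Gamma>"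
  by (auto simp: realizes_env_def intro: rlz_mono)

lemma realizes_env_Cons:
  "s \<in> rlz (stacks A \<xi>) F \<Longrightarrow> realizes_env \<xi> F \<tau> \<Gamma> \<Longrightarrow> realizes_env \<xi> F (case_nat s \<tau>) (A # \<Gamma>)"
  by (auto simp: realizes_env_def nth_Cons split: nat.splits)

text \<open>The common argument for all elimination rules that only push one element on the stack:
  running \<open>uelim t \<zeta>\<close> against a stack is running \<open>t\<close> against the
  longer stack.\<close>

lemma rlz_elim:
  assumes "t \<in> rlz R F" and "\<And>E \<sigma>. \<sigma> \<in> S (E @ F) \<Longrightarrow> kren (\<lambda>i. i + length E) \<zeta> # \<sigma> \<in> R (E @ F)"
  shows "uelim t \<zeta> \<in> rlz S F"
proof (rule rlzI)
  fix E \<sigma> assume "\<sigma> \<in> S (E @ F)"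
  then show "pole (E @ F) (uelims (ush (length E) (uelim t \<zeta>)) \<sigma>)"
    using rlzD[OF assms(1) assms(2), of \<sigma> E] by (cases \<zeta>) simp_all
qed

lemma ush_uup: "uren (up_ren \<rho>) (usubst (uup \<tau>) t) = usubst (uup (\<lambda>i. uren \<rho> (\<tau> i))) t"
  by (simp add: uren_uup)

text \<open>The body must be good in all extensions because the argument on the stack may use
  channels bound after the abstraction was formed.\<close>

lemma rlz_Lam:
  assumes "\<And>E s. s \<in> rlz (stacks A \<xi>) (E @ F) \<Longrightarrow>
    uinst s (uren (up_ren (\<lambda>i. i + length E)) t) \<in> rlz (stacks B \<xi>) (E @ F)"
  shows "ULam t \<in> rlz (stacks (Imp A B) \<xi>) F"
proof (rule rlzI)
  fix E \<sigma> assume "\<sigma> \<in> stacks (Imp A B) \<xi> (E @ F)"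
  then obtain s \<sigma>' where "\<sigma> = KArg s # \<sigma>'" "s \<in> rlz (stacks A \<xi>) (E @ F)"
    "\<sigma>' \<in> stacks B \<xi> (E @ F)" by auto
  then show "pole (E @ F) (uelims (ush (length E) (ULam t)) \<sigma>)"
    by (auto intro!: pole_red[OF ured.beta] rlz_pole assms)
qed

text \<open>These are the three conditions that a stack of a disjunction has to meet. The third
  reduces to the first branch, with \<open>UAbort\<close> as the realizer of its variable.\<close>

lemma KCase_pole:
  assumes w: "\<And>E s. s \<in> rlz R (E @ F) \<Longrightarrow>
      uinst s (uren (up_ren (\<lambda>i. i + length E)) w) \<in> rlz S (E @ F)"
    and w': "\<And>E s. s \<in> rlz R' (E @ F) \<Longrightarrow>
      uinst s (uren (up_ren (\<lambda>i. i + length E)) w') \<in> rlz S (E @ F)"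
    and cand: "candidate R" "candidate S" and \<sigma>: "\<sigma> \<in> S F"
  shows "s \<in> rlz R (E @ F) \<Longrightarrow> pole (E @ F) (uelims (UIn0 s) (ksh (length E) (KCase w w' # \<sigma>)))"
    and "s \<in> rlz R' (E @ F) \<Longrightarrow> pole (E @ F) (uelims (UIn1 s) (ksh (length E) (KCase w w' # \<sigma>)))"
    and "pole (E @ F) (uelims UAbort (ksh (length E) (KCase w w' # \<sigma>)))"
proof -
  have S: "ksh (length E) \<sigma> \<in> S (E @ F)" by (rule candidate_mono[OF cand(2) \<sigma>])
  show "pole (E @ F) (uelims (UIn0 s) (ksh (length E) (KCase w w' # \<sigma>)))" if "s \<in> rlz R (E @ F)"
    using pole_red[OF ured.case0 rlz_pole[OF w[OF that] S]] by simp
  show "pole (E @ F) (uelims (UIn1 s) (ksh (length E) (KCase w w' # \<sigma>)))" if "s \<in> rlz R' (E @ F)"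
    using pole_red[OF ured.case1 rlz_pole[OF w'[OF that] S]] by simp
  show "pole (E @ F) (uelims UAbort (ksh (length E) (KCase w w' # \<sigma>)))"
    using pole_red[OF ured.abort_case rlz_pole[OF w[OF candidate_abort[OF cand(1)]] S]] by simp
qed

lemma rlz_Case:
  assumes u: "u \<in> rlz (stacks (Or A B) \<xi>) F" and \<xi>: "\<forall>X. candidate (\<xi> X)"
    and w: "\<And>E s. s \<in> rlz (stacks A \<xi>) (E @ F) \<Longrightarrow>
      uinst s (uren (up_ren (\<lambda>i. i + length E)) w) \<in> rlz (stacks C \<xi>) (E @ F)"
    and w': "\<And>E s. s \<in> rlz (stacks B \<xi>) (E @ F) \<Longrightarrow>
      uinst s (uren (up_ren (\<lambda>i. i + length E)) w') \<in> rlz (stacks C \<xi>) (E @ F)"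
  shows "UCase u w w' \<in> rlz (stacks C \<xi>) F"
proof -
  have "uelim u (KCase w w') \<in> rlz (stacks C \<xi>) F"
  proof (rule rlz_elim[OF u])
    fix E \<sigma> assume \<sigma>: "\<sigma> \<in> stacks C \<xi> (E @ F)"
    have "uinst s (uren (up_ren (\<lambda>i. i + length E')) (uren (up_ren (\<lambda>i. i + length E)) w))
        \<in> rlz (stacks C \<xi>) (E' @ E @ F)" if "s \<in> rlz (stacks A \<xi>) (E' @ E @ F)" for E' s
      using w[of s "E' @ E"] that by (simp add: ac_simps)
    moreover have "uinst s (uren (up_ren (\<lambda>i. i + length E')) (uren (up_ren (\<lambda>i. i + length E)) w'))
        \<in> rlz (stacks C \<xi>) (E' @ E @ F)" if "s \<in> rlz (stacks B \<xi>) (E' @ E @ F)" for E' s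
      using w'[of s "E' @ E"] that by (simp add: ac_simps)
    ultimately show "kren (\<lambda>i. i + length E) (KCase w w') # \<sigma> \<in> stacks (Or A B) \<xi> (E @ F)"
      unfolding stacks.simps kren.simps mem_Collect_eq
      by (intro allI conjI ballI KCase_pole[where R = "stacks A \<xi>" and R' = "stacks B \<xi>" and S = "stacks C \<xi>", OF _ _ _ _ \<sigma>] candidate_stacks[OF \<xi>])
  qed
  then show ?thesis by simp
qed

lemma rlz_ExE:
  assumes u: "u \<in> rlz (stacks (Exi A) \<xi>) F" and \<xi>: "\<forall>X. candidate (\<xi> X)"
    and w: "\<And>E s. s \<in> rlz (stacks A \<xi>) (E @ F) \<Longrightarrow>
      uinst s (uren (up_ren (\<lambda>i. i + length E)) w) \<in> rlz (stacks C \<xi>) (E @ F)"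
  shows "UCase u w w \<in> rlz (stacks C \<xi>) F"
proof -
  have "uelim u (KCase w w) \<in> rlz (stacks C \<xi>) F"
  proof (rule rlz_elim[OF u])
    fix E \<sigma> assume \<sigma>: "\<sigma> \<in> stacks C \<xi> (E @ F)"
    have "uinst s (uren (up_ren (\<lambda>i. i + length E')) (uren (up_ren (\<lambda>i. i + length E)) w))
        \<in> rlz (stacks C \<xi>) (E' @ E @ F)" if "s \<in> rlz (stacks A \<xi>) (E' @ E @ F)" for E' s
      using w[of s "E' @ E"] that by (simp add: ac_simps)
    then show "kren (\<lambda>i. i + length E) (KCase w w) # \<sigma> \<in> stacks (Exi A) \<xi> (E @ F)"
      unfolding stacks.simps kren.simps mem_Collect_eq
      by (intro allI conjI ballI KCase_pole(1,3)[where R = "stacks A \<xi>" and R' = "stacks A \<xi>" and S = "stacks C \<xi>", OF _ _ _ _ \<sigma>] candidate_stacks[OF \<xi>])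
  qed
  then show ?thesis by simp
qed

text \<open>Messages have this form. The dummy argument is discarded, so a realizer of
  \<open>A\<close> suffices whatever \<open>B\<close> is.\<close>

lemma rlz_const_Lam:
  assumes "s \<in> rlz (stacks A \<xi>) F"
  shows "ULam (uren Suc s) \<in> rlz (stacks (Imp B A) \<xi>) F"
proof (rule rlz_Lam)
  fix E :: "utm list" and s'
  have "uinst s' (uren (up_ren (\<lambda>i. i + length E)) (uren Suc s)) = ush (length E) s"
    by (simp add: uinst_def usubst_var)
  then show "uinst s' (uren (up_ren (\<lambda>i. i + length E)) (uren Suc s)) \<in> rlz (stacks A \<xi>) (E @ F)"
    using rlz_mono[OF assms] by simp
qed

lemma rlz_unbox_intro:
  assumes "\<And>E \<sigma>. \<sigma> \<in> R (E @ F) \<Longrightarrow> \<exists>\<sigma>'. \<sigma> = KUnbox # \<sigma>' \<and> pole (E @ F) (uelims (ush (length E) t) \<sigma>')"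
  shows "UBox t \<in> rlz R F"
  by (rule rlzI) (use assms in \<open>force intro: pole_red[OF ured.box]\<close>)

text \<open>A channel realizes its type because the stack that it meets contains the message needed
  to discharge the channel in the partner process.\<close>

lemma rlz_channel:
  assumes v: "\<And>E s. s \<in> rlz (stacks A \<xi>) (E @ v # F) \<Longrightarrow>
    pole (E @ v # F) (usubst (ucomm s (length E)) v)"
  shows "UV 0 \<in> rlz (stacks (Imp A B) \<xi>) (v # F)"
proof (rule rlzI)
  fix E \<sigma> assume "\<sigma> \<in> stacks (Imp A B) \<xi> (E @ v # F)"
  then obtain s \<sigma>' where *: "\<sigma> = KArg s # \<sigma>'" "s \<in> rlz (stacks A \<xi>) (E @ v # F)" by auto
  from v[OF this(2)] obtain U where "ev (E @ v # F) (usubst (ucomm s (length E)) v) U"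
    by (auto simp: pole_def)
  then show "pole (E @ v # F) (uelims (ush (length E) (UV 0)) \<sigma>)"
    using ev.comm[of "length E" "E @ v # F" s U \<sigma>'] by (auto simp: pole_def *)
qed

text \<open>What a partner \<open>v\<close> against \<open>\<sigma>\<close> becomes when moved into
  a hole at depth \<open>n\<close>: its channel is replaced by the constant message, while
  environment and stack, which live outside the binder of the channel, are merely shifted past
  \<open>Suc n\<close> binders.\<close>

lemma usubst_ucomm:
  "usubst (ucomm s n) (uelims (usubst (uup \<tau>) v) (map (kren Suc) \<sigma>)) =
   uelims (usubst (case_nat (ULam (uren Suc s)) (\<lambda>i. ush (Suc n) (\<tau> i))) v) (ksh (Suc n) \<sigma>)"
proof -
  have "(\<lambda>i. usubst (ucomm s n) (uup \<tau> i)) = case_nat (ULam (uren Suc s)) (\<lambda>i. ush (Suc n) (\<tau> i))"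
    by (auto simp: fun_eq_iff ucomm_def uup_def usubst_var split: nat.split)
  moreover have "ksubst (ucomm s n) (kren Suc \<zeta>) = kren (\<lambda>i. i + Suc n) \<zeta>" for \<zeta>
    using ksubst_var[of "\<lambda>i. i + Suc n" \<zeta>] by (simp add: ksubst_kren ucomm_def)
  ultimately show ?thesis by (simp add: usubst_uelims o_def)
qed

text \<open>Two rounds avoid a circularity between the processes. The left one runs beside the
  unevaluated right one, whose channel any message replaces by a realizer; the right one then runs
  beside the values obtained from the left.\<close>

lemma rlz_Par:
  assumes C: "\<forall>X. candidate (\<xi> X)"
    and u: "\<And>E s. s \<in> rlz (stacks (Imp A B) \<xi>) (E @ F) \<Longrightarrow>
      usubst (case_nat s (\<lambda>i. ush (length E) (\<tau> i))) u \<in> rlz (stacks C \<xi>) (E @ F)"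
    and v: "\<And>E s. s \<in> rlz (stacks (Imp B A) \<xi>) (E @ F) \<Longrightarrow>
      usubst (case_nat s (\<lambda>i. ush (length E) (\<tau> i))) v \<in> rlz (stacks C \<xi>) (E @ F)"
  shows "usubst \<tau> (UPar u v) \<in> rlz (stacks C \<xi>) F"
proof (rule rlzI)
  fix E \<sigma> assume \<sigma>: "\<sigma> \<in> stacks C \<xi> (E @ F)"
  define \<tau>' where "\<tau>' = (\<lambda>i. ush (length E) (\<tau> i))"
  define u' where "u' = uelims (usubst (uup \<tau>') u) (map (kren Suc) \<sigma>)"
  define v' where "v' = uelims (usubst (uup \<tau>') v) (map (kren Suc) \<sigma>)"
  have \<sigma>_mono: "ksh (length E') \<sigma> \<in> stacks C \<xi> (E' @ E @ F)" for E'
    using candidate_mono[OF candidate_stacks[OF C] \<sigma>] .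
  have up: "uup \<rho> = case_nat (UV 0) (\<lambda>i. ush 1 (\<rho> i))" for \<rho>
    by (simp add: uup_def)
  \<comment> \<open>The requirement of \<open>rlz_channel\<close>: a message \<open>s\<close> turns
    \<open>v'\<close> into an instance of \<open>v\<close> whose channel is a constant function, and
    the assumption on \<open>v\<close> applies to that.\<close>
  have "pole (E' @ v' # E @ F) (usubst (ucomm s (length E')) v')"
    if "s \<in> rlz (stacks A \<xi>) (E' @ v' # E @ F)" for E' s
  proof -
    have "usubst (case_nat (ULam (uren Suc s)) (\<lambda>i. ush (length (E' @ v' # E)) (\<tau> i))) v
      \<in> rlz (stacks C \<xi>) ((E' @ v' # E) @ F)"
      by (rule v) (use rlz_const_Lam[OF that] in simp)
    from rlz_pole[OF this, of "ksh (length (E' @ [v'])) \<sigma>"] \<sigma>_mono[of "E' @ [v']"] show ?thesis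
      unfolding v'_def usubst_ucomm \<tau>'_def by (simp add: ac_simps)
  qed
  then have "UV 0 \<in> rlz (stacks (Imp A B) \<xi>) ((v' # E) @ F)"
    using rlz_channel[of A \<xi> v' "E @ F" B] by simp
  from rlz_pole[OF u[OF this], of "map (kren Suc) \<sigma>"] \<sigma>_mono[of "[v']"]
  have "pole (v' # E @ F) u'"
    by (simp add: u'_def \<tau>'_def up)
  then obtain U where U: "ev (v' # E @ F) u' U" by (auto simp: pole_def)
  \<comment> \<open>Values remain values under any substitution, so here the message may be
    arbitrary.\<close>
  have "pole (E' @ U # E @ F) (usubst (ucomm s (length E')) U)" for E' s
    using U by (intro pole_uvalues uvalues_usubst ev_uvalues)
  then have "UV 0 \<in> rlz (stacks (Imp B A) \<xi>) ((U # E) @ F)"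
    using rlz_channel[of B \<xi> U "E @ F" A] by simp
  from rlz_pole[OF v[OF this], of "map (kren Suc) \<sigma>"] \<sigma>_mono[of "[U]"]
  have "pole (U # E @ F) v'"
    by (simp add: v'_def \<tau>'_def up)
  with U have "pole (E @ F) (UPar u' v')" by (auto simp: pole_def intro: ev.par)
  then show "pole (E @ F) (uelims (ush (length E) (usubst \<tau> (UPar u v))) \<sigma>)"
    by (simp add: u'_def v'_def \<tau>'_def ush_uup pole_perm uren_uup)
qed

lemma adequacy:
  assumes "typing L \<Gamma> t A" "\<forall>X. candidate (\<xi> X)" "realizes_env \<xi> F \<tau> \<Gamma>"
  shows "usubst \<tau> (er t) \<in> rlz (stacks A \<xi>) F"
  using assms
proof (induction arbitrary: \<xi> F \<tau> rule: typing.induct)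
  case (PV i \<Gamma> A)
  then show ?case by (auto simp: realizes_env_def)
next
  case (Tup \<Gamma> u A t B)
  show ?case
  proof (rule rlzI)
    fix E \<sigma> assume "\<sigma> \<in> stacks (And A B) \<xi> (E @ F)"
    moreover have *: "ush (length E) (usubst \<tau> (er u)) \<in> rlz (stacks A \<xi>) (E @ F)"
      "ush (length E) (usubst \<tau> (er t)) \<in> rlz (stacks B \<xi>) (E @ F)"
      using Tup by (auto simp del: uren_usubst intro: rlz_mono)
    ultimately show "pole (E @ F) (uelims (ush (length E) (usubst \<tau> (er (Tup u t)))) \<sigma>)"
      by (auto simp del: uren_usubst
        intro: pole_red[OF ured.proj0 rlz_pole[OF *(1)]] pole_red[OF ured.proj1 rlz_pole[OF *(2)]])
  qed
next
  case (Pr0 \<Gamma> u A B)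
  from rlz_elim[OF Pr0.IH[OF Pr0.prems], of _ KPr0] show ?case by simp
next
  case (Pr1 \<Gamma> u A B)
  from rlz_elim[OF Pr1.IH[OF Pr1.prems], of _ KPr1] show ?case by simp
next
  case (App \<Gamma> t A B u)
  from rlz_elim[OF App.IH(1)[OF App.prems], of _ "KArg (usubst \<tau> (er u))"]
    rlz_mono[OF App.IH(2)[OF App.prems]]
  show ?case by simp
next
  case (Lam A \<Gamma> u B)
  have "uinst s (uren (up_ren (\<lambda>i. i + length E)) (usubst (uup \<tau>) (er u))) \<in> rlz (stacks B \<xi>) (E @ F)"
    if "s \<in> rlz (stacks A \<xi>) (E @ F)" for E s
    using Lam.IH[OF Lam.prems(1) realizes_env_Cons[OF that realizes_env_mono[OF Lam.prems(2)]]]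
    unfolding usubst_uinst ush_uup .
  then show ?case unfolding er.simps usubst.simps by (rule rlz_Lam)
next
  case (In0 \<Gamma> u A B)
  show ?case
  proof (rule rlzI)
    fix E \<sigma> assume "\<sigma> \<in> stacks (Or A B) \<xi> (E @ F)"
    then show "pole (E @ F) (uelims (ush (length E) (usubst \<tau> (er (In0 u)))) \<sigma>)"
      using In0.IH[OF In0.prems(1) realizes_env_mono[OF In0.prems(2), of E]]
      by (auto simp: ksh_0 dest!: spec[of _ "[]"])
  qed
next
  case (In1 \<Gamma> u B A)
  show ?case
  proof (rule rlzI)
    fix E \<sigma> assume "\<sigma> \<in> stacks (Or A B) \<xi> (E @ F)"
    then show "pole (E @ F) (uelims (ush (length E) (usubst \<tau> (er (In1 u)))) \<sigma>)"
      using In1.IH[OF In1.prems(1) realizes_env_mono[OF In1.prems(2), of E]]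
      by (auto simp: ksh_0 dest!: spec[of _ "[]"])
  qed
next
  case (Case \<Gamma> u A B w1 C w2)
  have w: "uinst s (uren (up_ren (\<lambda>i. i + length E)) (usubst (uup \<tau>) (er w1))) \<in> rlz (stacks C \<xi>) (E @ F)"
    if "s \<in> rlz (stacks A \<xi>) (E @ F)" for E s
    using Case.IH(2)[OF Case.prems(1) realizes_env_Cons[OF that realizes_env_mono[OF Case.prems(2)]]]
    unfolding usubst_uinst ush_uup .
  have w': "uinst s (uren (up_ren (\<lambda>i. i + length E)) (usubst (uup \<tau>) (er w2))) \<in> rlz (stacks C \<xi>) (E @ F)"
    if "s \<in> rlz (stacks B \<xi>) (E @ F)" for E s
    using Case.IH(3)[OF Case.prems(1) realizes_env_Cons[OF that realizes_env_mono[OF Case.prems(2)]]]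
    unfolding usubst_uinst ush_uup .
  show ?case
    unfolding er.simps usubst.simps by (rule rlz_Case[OF Case.IH(1)[OF Case.prems] Case.prems(1) w w'])
next
  case (IApp \<Gamma> u A m)
  from rlz_elim[OF IApp.IH[OF IApp.prems], of _ KUnbox] show ?case by simp
next
  case (ILam \<Gamma> u A)
  have "realizes_env \<xi> F \<tau> (map (isubst_fm shift_tm) \<Gamma>)"
    using ILam.prems(2) by (simp add: realizes_env_def)
  from ILam.IH[OF ILam.prems(1) this] show ?case
    unfolding er.simps usubst.simps by (intro rlz_unbox_intro) (auto dest: rlzD)
next
  case (Wit A m \<Gamma> u)
  show ?case
  proof (rule rlzI)
    fix E \<sigma> assume "\<sigma> \<in> stacks (Exi A) \<xi> (E @ F)"
    then show "pole (E @ F) (uelims (ush (length E) (usubst \<tau> (er (Wit m u)))) \<sigma>)"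
      using Wit.IH[OF Wit.prems(1) realizes_env_mono[OF Wit.prems(2), of E]]
      by (auto simp: ksh_0 dest!: spec[of _ "[]"])
  qed
next
  case (ExE \<Gamma> u A t C)
  have env: "realizes_env \<xi> F \<tau> (map (isubst_fm shift_tm) \<Gamma>)"
    using ExE.prems(2) by (simp add: realizes_env_def)
  have w: "uinst s (uren (up_ren (\<lambda>i. i + length E)) (usubst (uup \<tau>) (er t))) \<in> rlz (stacks C \<xi>) (E @ F)"
    if "s \<in> rlz (stacks A \<xi>) (E @ F)" for E s
    using ExE.IH(2)[OF ExE.prems(1) realizes_env_Cons[OF that realizes_env_mono[OF env]]]
    unfolding usubst_uinst ush_uup stacks_isubst .
  show ?case
    unfolding er.simps usubst.simps by (rule rlz_ExE[OF ExE.IH(1)[OF ExE.prems] ExE.prems(1) w])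
next
  case (Par A B \<Gamma> u C v)
  show ?case unfolding er.simps
    by (rule rlz_Par[OF Par.prems(1)];
      rule Par.IH[OF Par.prems(1) realizes_env_Cons[OF _ realizes_env_mono[OF Par.prems(2)]]])
next
  case (Efq P \<Gamma> u)
  then show ?case by (auto intro!: candidate_abort candidate_stacks)
next
  case (PLam \<Gamma> t A)
  \<comment> \<open>The context is renamed by \<open>Suc\<close>, so its interpretation does not
    depend on \<open>R\<close> and the environment can be reused for every candidate.\<close>
  have "usubst \<tau> (er t) \<in> rlz (stacks A (case_nat R \<xi>)) F" if "candidate R" for R
  proof (rule PLam.IH)
    show "\<forall>X. candidate (case_nat R \<xi> X)"
      by (rule candidate_case_nat[OF that PLam.prems(1)])
    show "realizes_env (case_nat R \<xi>) F \<tau> (map (pren_fm Suc) \<Gamma>)"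
      using PLam.prems(2) by (simp add: realizes_env_def stacks_pren)
  qed
  then show ?case
    unfolding er.simps usubst.simps
    by (intro rlz_unbox_intro) (auto simp del: uren_usubst intro: rlzD[rotated])
next
  case (PApp \<Gamma> t A B)
  \<comment> \<open>The candidate chosen for the bound predicate variable is
    \<open>stacks B \<xi>\<close>.\<close>
  from rlz_elim[OF PApp.IH[OF PApp.prems], of "stacks (pinst_fm B A) \<xi>" KUnbox] 
    candidate_stacks[OF PApp.prems(1)]
  show ?case by (force simp: stacks_pinst)
qed

text \<open>Normalization of erased terms: adequacy for the empty world and the empty stack.\<close>

lemma typing_Exi_ev:
  assumes "typing L [] t (Exi A)"
  shows "\<exists>U. ev [] (er t) U"
proof -
  define \<xi> :: "nat \<Rightarrow> cand" where "\<xi> = (\<lambda>_ _. {})"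
  have "usubst UV (er t) \<in> rlz (stacks (Exi A) \<xi>) []"
    by (rule adequacy[OF assms]) (auto simp: realizes_env_def candidate_def \<xi>_def)
  \<comment> \<open>Against the empty stack, and its shifts, an injection or \<open>UAbort\<close>
    is already a value.\<close>
  moreover have "[] \<in> stacks (Exi A) \<xi> []"
    by (auto intro: pole_uvalues uvalues.intros)
  ultimately show ?thesis
    using rlz_pole by (fastforce simp: pole_def)
qed

section \<open>Substitution in formulas\<close>

lemma up_tm_simps [simp]: "up_tm \<sigma> 0 = Var 0" "up_tm \<sigma> (Suc n) = subst_tm shift_tm (\<sigma> n)"
  by (simp_all add: up_tm_def)

lemma subst_tm_subst_tm [simp]: "subst_tm \<sigma> (subst_tm \<sigma>' m) = subst_tm (\<lambda>n. subst_tm \<sigma> (\<sigma>' n)) m"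
  by (induction m) simp_all

lemma subst_tm_Var [simp]: "subst_tm Var m = m"
  by (induction m) (simp_all add: map_idI)

lemma up_tm_shift: "(\<lambda>n. subst_tm (up_tm \<sigma>) (shift_tm n)) = (\<lambda>n. subst_tm shift_tm (\<sigma> n))"
  by (simp add: fun_eq_iff shift_tm_def)

lemma case_nat_shift: "(\<lambda>n. subst_tm (case_nat m Var) (shift_tm n)) = Var"
  by (simp add: fun_eq_iff shift_tm_def)

lemma up_tm_comp: "(\<lambda>n. subst_tm (up_tm \<sigma>) (up_tm \<sigma>' n)) = up_tm (\<lambda>n. subst_tm \<sigma> (\<sigma>' n))"
  by (auto simp: fun_eq_iff up_tm_def up_tm_shift[unfolded up_tm_def] split: nat.split)

lemma up_tm_Var [simp]: "up_tm Var = Var"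
  by (auto simp: fun_eq_iff up_tm_def shift_tm_def split: nat.split)

lemma isubst_isubst_fm: "isubst_fm \<sigma> (isubst_fm \<sigma>' A) = isubst_fm (\<lambda>n. subst_tm \<sigma> (\<sigma>' n)) A"
  by (induction A arbitrary: \<sigma> \<sigma>') (simp_all add: up_tm_comp)

lemma isubst_fm_Var [simp]: "isubst_fm Var A = A"
  by (induction A) (simp_all add: map_idI)

lemma isubst_shift_fm:
  "isubst_fm (up_tm \<sigma>) (isubst_fm shift_tm A) = isubst_fm shift_tm (isubst_fm \<sigma> A)"
  by (simp add: isubst_isubst_fm up_tm_shift)

lemma isubst_up_shift_fm:
  "isubst_fm (up_tm (up_tm \<sigma>)) (isubst_fm (up_tm shift_tm) A) =
   isubst_fm (up_tm shift_tm) (isubst_fm (up_tm \<sigma>) A)"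
  by (simp add: isubst_isubst_fm up_tm_comp up_tm_shift)

lemma subst_tm_case_nat:
  "(\<lambda>n. subst_tm \<sigma> (case_nat m Var n)) = (\<lambda>n. subst_tm (case_nat (subst_tm \<sigma> m) Var) (up_tm \<sigma> n))"
  by (auto simp: fun_eq_iff up_tm_def case_nat_shift split: nat.split)

lemma isubst_inst_fm: "isubst_fm \<sigma> (inst_fm m A) = inst_fm (subst_tm \<sigma> m) (isubst_fm (up_tm \<sigma>) A)"
  by (simp add: inst_fm_def isubst_isubst_fm subst_tm_case_nat)

lemma pren_pren_fm: "pren_fm \<rho> (pren_fm \<rho>' A) = pren_fm (\<lambda>i. \<rho> (\<rho>' i)) A"
  by (induction A arbitrary: \<rho> \<rho>') simp_all

lemma pren_isubst_fm: "pren_fm \<rho> (isubst_fm \<sigma> A) = isubst_fm \<sigma> (pren_fm \<rho> A)"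
  by (induction A arbitrary: \<rho> \<sigma>) simp_all

lemma pren_inst_fm: "pren_fm \<rho> (inst_fm m A) = inst_fm m (pren_fm \<rho> A)"
  by (simp add: inst_fm_def pren_isubst_fm)

lemma up_ps_simps [simp]: "up_ps \<theta> 0 = id_ps 0" "up_ps \<theta> (Suc X) = pren_fm Suc (\<theta> X)"
  by (simp_all add: up_ps_def)

lemma isubst_id_ps [simp]: "isubst_fm (up_tm \<sigma>) (id_ps X) = id_ps X"
  by (simp add: id_ps_def)

lemma pren_id_ps [simp]: "pren_fm \<rho> (id_ps X) = id_ps (\<rho> X)"
  by (simp add: id_ps_def)

lemma inst_id_ps [simp]: "inst_fm m (id_ps X) = PVar X m"
  by (simp add: inst_fm_def id_ps_def)

lemma ilift_id_ps [simp]: "ilift_ps id_ps = id_ps"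
  by (simp add: ilift_ps_def fun_eq_iff)

lemma up_id_ps [simp]: "up_ps id_ps = id_ps"
  by (auto simp: up_ps_def fun_eq_iff split: nat.split)

lemma psubst_id_fm [simp]: "psubst_fm id_ps A = A"
  by (induction A) simp_all

lemma isubst_psubst_fm:
  "isubst_fm \<sigma> (psubst_fm \<theta> A) = psubst_fm (\<lambda>X. isubst_fm (up_tm \<sigma>) (\<theta> X)) (isubst_fm \<sigma> A)"
proof (induction A arbitrary: \<sigma> \<theta>)
  case (Uni2 A)
  have "(\<lambda>X. isubst_fm (up_tm \<sigma>) (up_ps \<theta> X)) = up_ps (\<lambda>X. isubst_fm (up_tm \<sigma>) (\<theta> X))"
    by (auto simp: fun_eq_iff up_ps_def pren_isubst_fm split: nat.split)
  then show ?case by (simp add: Uni2)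
qed (simp_all add: isubst_inst_fm ilift_ps_def isubst_up_shift_fm)

lemma pren_psubst_fm: "pren_fm \<rho> (psubst_fm \<theta> A) = psubst_fm (\<lambda>X. pren_fm \<rho> (\<theta> X)) A"
proof (induction A arbitrary: \<rho> \<theta>)
  case (Uni2 A)
  have "(\<lambda>X. pren_fm (up_ren \<rho>) (up_ps \<theta> X)) = up_ps (\<lambda>X. pren_fm \<rho> (\<theta> X))"
    by (auto simp: fun_eq_iff up_ps_def pren_pren_fm split: nat.split)
  then show ?case by (simp add: Uni2)
qed (simp_all add: pren_inst_fm ilift_ps_def pren_isubst_fm)

lemma psubst_pren_fm: "psubst_fm \<theta> (pren_fm \<rho> A) = psubst_fm (\<lambda>X. \<theta> (\<rho> X)) A"
proof (induction A arbitrary: \<rho> \<theta>)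
  case (Uni2 A)
  have "(\<lambda>X. up_ps \<theta> (up_ren \<rho> X)) = up_ps (\<lambda>X. \<theta> (\<rho> X))"
    by (auto simp: fun_eq_iff up_ps_def up_ren_def split: nat.split)
  then show ?case by (simp add: Uni2)
qed (simp_all add: ilift_ps_def)

lemma isubst_ilift_ps: "(\<lambda>X. isubst_fm (up_tm (case_nat m Var)) (ilift_ps \<theta> X)) = \<theta>"
  by (simp add: ilift_ps_def isubst_isubst_fm up_tm_comp case_nat_shift)

lemma psubst_inst_fm: "psubst_fm \<theta> (inst_fm m A) = inst_fm m (psubst_fm (ilift_ps \<theta>) A)"
  by (simp add: inst_fm_def isubst_psubst_fm isubst_ilift_ps)

lemma psubst_shift_fm: "psubst_fm (ilift_ps \<theta>) (isubst_fm shift_tm A) = isubst_fm shift_tm (psubst_fm \<theta> A)"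
  by (simp add: isubst_psubst_fm ilift_ps_def)

lemma psubst_up_shift_fm:
  "psubst_fm (ilift_ps (ilift_ps \<theta>)) (isubst_fm (up_tm shift_tm) A) =
   isubst_fm (up_tm shift_tm) (psubst_fm (ilift_ps \<theta>) A)"
  by (simp add: isubst_psubst_fm ilift_ps_def isubst_up_shift_fm)

lemma psubst_up_pren_fm: "psubst_fm (up_ps \<theta>) (pren_fm Suc A) = pren_fm Suc (psubst_fm \<theta> A)"
  by (simp add: psubst_pren_fm pren_psubst_fm)

lemma ilift_up_ps: "ilift_ps (up_ps \<theta>) = up_ps (ilift_ps \<theta>)"
  by (auto simp: fun_eq_iff ilift_ps_def up_ps_def pren_isubst_fm split: nat.split)

lemma psubst_id_ps [simp]:
  fixes \<theta> :: "nat \<Rightarrow> ('f, 'p) fm"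
  shows "psubst_fm (ilift_ps \<theta>) (id_ps X) = \<theta> X"
proof -
  have "(\<lambda>n. subst_tm (case_nat (Var 0) Var) (up_tm shift_tm n)) = (Var :: nat \<Rightarrow> 'f tm)"
    by (auto simp: fun_eq_iff up_tm_def shift_tm_def split: nat.split)
  then show ?thesis
    by (simp add: id_ps_def ilift_ps_def inst_fm_def isubst_isubst_fm)
qed

text \<open>The formula \<open>\<theta>' X\<close> abstracts one individual variable, so
  \<open>\<theta>\<close> enters it lifted. The quantifier cases move \<open>\<theta>\<close> past
  this second lifting.\<close>

lemma psubst_psubst_fm:
  "psubst_fm \<theta> (psubst_fm \<theta>' A) = psubst_fm (\<lambda>X. psubst_fm (ilift_ps \<theta>) (\<theta>' X)) A"
proof (induction A arbitrary: \<theta> \<theta>')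
  case (Uni2 A)
  have "(\<lambda>X. psubst_fm (ilift_ps (up_ps \<theta>)) (up_ps \<theta>' X)) = up_ps (\<lambda>X. psubst_fm (ilift_ps \<theta>) (\<theta>' X))"
  proof
    fix X
    show "psubst_fm (ilift_ps (up_ps \<theta>)) (up_ps \<theta>' X) = up_ps (\<lambda>X. psubst_fm (ilift_ps \<theta>) (\<theta>' X)) X"
      using psubst_id_ps[of "up_ps \<theta>" 0] by (cases X) (simp_all add: ilift_up_ps psubst_up_pren_fm)
  qed
  then show ?case by (simp add: Uni2)
next
  case (Uni A)
  have "(\<lambda>X. psubst_fm (ilift_ps (ilift_ps \<theta>)) (ilift_ps \<theta>' X)) =
    ilift_ps (\<lambda>X. psubst_fm (ilift_ps \<theta>) (\<theta>' X))"
    unfolding ilift_ps_def[of \<theta>'] psubst_up_shift_fm by (simp add: ilift_ps_def)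
  then show ?case by (simp add: Uni)
next
  case (Exi A)
  have "(\<lambda>X. psubst_fm (ilift_ps (ilift_ps \<theta>)) (ilift_ps \<theta>' X)) =
    ilift_ps (\<lambda>X. psubst_fm (ilift_ps \<theta>) (\<theta>' X))"
    unfolding ilift_ps_def[of \<theta>'] psubst_up_shift_fm by (simp add: ilift_ps_def)
  then show ?case by (simp add: Exi)
qed (simp_all add: psubst_inst_fm)

lemma isubst_pinst_fm:
  "isubst_fm \<sigma> (pinst_fm B A) = pinst_fm (isubst_fm (up_tm \<sigma>) B) (isubst_fm \<sigma> A)"
proof -
  have "(\<lambda>X. isubst_fm (up_tm \<sigma>) (case_nat B id_ps X)) = case_nat (isubst_fm (up_tm \<sigma>) B) id_ps"
    by (auto simp: fun_eq_iff split: nat.split)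
  then show ?thesis by (simp add: pinst_fm_def isubst_psubst_fm)
qed

lemma pren_pinst_fm: "pren_fm \<rho> (pinst_fm B A) = pinst_fm (pren_fm \<rho> B) (pren_fm (up_ren \<rho>) A)"
proof -
  have "(\<lambda>X. pren_fm \<rho> (case_nat B id_ps X)) = (\<lambda>X. case_nat (pren_fm \<rho> B) id_ps (up_ren \<rho> X))"
    by (auto simp: fun_eq_iff split: nat.split)
  then show ?thesis by (simp add: pinst_fm_def pren_psubst_fm psubst_pren_fm)
qed

lemma psubst_pinst_fm:
  "psubst_fm \<theta> (pinst_fm B A) = pinst_fm (psubst_fm (ilift_ps \<theta>) B) (psubst_fm (up_ps \<theta>) A)"
proof -
  \<comment> \<open>After renaming by \<open>Suc\<close> the instantiated predicate variable does
    not occur, so the instantiation has no effect.\<close>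
  have *: "psubst_fm (ilift_ps (case_nat C id_ps)) (pren_fm Suc B) = B" for C B :: "('a, 'b) fm"
    using psubst_id_fm by (simp add: psubst_pren_fm ilift_ps_def)
  have "(\<lambda>X. psubst_fm (ilift_ps \<theta>) (case_nat B id_ps X)) =
    (\<lambda>X. psubst_fm (ilift_ps (case_nat (psubst_fm (ilift_ps \<theta>) B) id_ps)) (up_ps \<theta> X))"
    by (auto simp: fun_eq_iff * split: nat.split)
  then show ?thesis by (simp add: pinst_fm_def psubst_psubst_fm)
qed

section \<open>Well-formedness\<close>

lemma wf_subst_tm: "wf_tm L m \<Longrightarrow> \<forall>n. wf_tm L (\<sigma> n) \<Longrightarrow> wf_tm L (subst_tm \<sigma> m)"
  by (induction m) auto

lemma wf_shift_tm [simp]: "wf_tm L (shift_tm n)"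
  by (simp add: shift_tm_def)

lemma wf_up_tm: "\<forall>n. wf_tm L (\<sigma> n) \<Longrightarrow> \<forall>n. wf_tm L (up_tm \<sigma> n)"
  by (auto simp: up_tm_def wf_subst_tm split: nat.split)

lemma wf_case_nat: "wf_tm L m \<Longrightarrow> \<forall>n. wf_tm L (case_nat m Var n)"
  by (auto split: nat.split)

lemma wf_isubst_fm: "wf_fm L A \<Longrightarrow> \<forall>n. wf_tm L (\<sigma> n) \<Longrightarrow> wf_fm L (isubst_fm \<sigma> A)"
  by (induction A arbitrary: \<sigma>) (auto simp: wf_subst_tm wf_up_tm)

lemma wf_inst_fm: "wf_fm L A \<Longrightarrow> wf_tm L m \<Longrightarrow> wf_fm L (inst_fm m A)"
  by (simp add: inst_fm_def wf_isubst_fm wf_case_nat)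

lemma wf_pren_fm [simp]: "wf_fm L (pren_fm \<rho> A) = wf_fm L A"
  by (induction A arbitrary: \<rho>) auto

lemma wf_ilift_ps: "\<forall>X. wf_fm L (\<theta> X) \<Longrightarrow> \<forall>X. wf_fm L (ilift_ps \<theta> X)"
  by (simp add: ilift_ps_def wf_isubst_fm wf_up_tm)

lemma wf_id_ps [simp]: "wf_fm L (id_ps X)"
  by (simp add: id_ps_def)

lemma wf_up_ps: "\<forall>X. wf_fm L (\<theta> X) \<Longrightarrow> \<forall>X. wf_fm L (up_ps \<theta> X)"
  by (auto simp: up_ps_def split: nat.split)

lemma wf_psubst_fm: "wf_fm L A \<Longrightarrow> \<forall>X. wf_fm L (\<theta> X) \<Longrightarrow> wf_fm L (psubst_fm \<theta> A)"
  by (induction A arbitrary: \<theta>) (auto simp: wf_inst_fm wf_ilift_ps wf_up_ps)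

text \<open>Lets \<open>Efq\<close> stay typable under individual substitution. Predicate
  substitution has no such law, which is why \<open>exfalso\<close> intervenes there.\<close>

lemma atomic_isubst [simp]: "atomic (isubst_fm \<sigma> P) = atomic P"
  by (cases P) simp_all

lemma atomic_pren [simp]: "atomic (pren_fm \<rho> P) = atomic P"
  by (cases P) simp_all

section \<open>Substitution preserves typing\<close>

lemma typing_ren:
  "typing L \<Gamma> t A \<Longrightarrow> \<forall>i<length \<Gamma>. \<rho> i < length \<Delta> \<and> \<Delta> ! \<rho> i = \<Gamma> ! i \<Longrightarrow> typing L \<Delta> (ren_pt \<rho> t) A"
proof (induction arbitrary: \<rho> \<Delta> rule: typing.induct)
  case (Par A B \<Gamma> u C v)
  show ?case unfolding ren_pt.simps
    by (rule typing.Par[OF Par.hyps(1,2)]; rule Par.IH)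
      (use Par.prems in \<open>auto simp: nth_Cons up_ren_def split: nat.split\<close>)
next
  case (Lam A \<Gamma> u B)
  show ?case unfolding ren_pt.simps
    by (rule typing.Lam[OF Lam.hyps(1)]; rule Lam.IH)
      (use Lam.prems in \<open>auto simp: nth_Cons up_ren_def split: nat.split\<close>)
next
  case (Case \<Gamma> u A B w1 C w2)
  show ?case unfolding ren_pt.simps
    by (rule typing.Case; rule Case.IH)
      (use Case.prems in \<open>auto simp: nth_Cons up_ren_def split: nat.split\<close>)
next
  case (ExE \<Gamma> u A t C)
  show ?case unfolding ren_pt.simps
    by (rule typing.ExE; rule ExE.IH)
      (use ExE.prems in \<open>auto simp: nth_Cons up_ren_def split: nat.split\<close>)
next
  case (ILam \<Gamma> u A)
  then show ?case by (auto intro!: typing.ILam ILam.IH)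
next
  case (PLam \<Gamma> u A)
  then show ?case by (auto intro!: typing.PLam PLam.IH)
next
  case (App \<Gamma> t A B u)
  show ?case unfolding ren_pt.simps
    by (rule typing.App; rule App.IH[OF App.prems])
qed (auto intro: typing.intros)

lemma typing_weaken: "typing L \<Gamma> t A \<Longrightarrow> typing L (B # \<Gamma>) (ren_pt Suc t) A"
  by (rule typing_ren) auto

lemma typing_isubst:
  "typing L \<Gamma> t A \<Longrightarrow> \<forall>n. wf_tm L (\<sigma> n) \<Longrightarrow>
    typing L (map (isubst_fm \<sigma>) \<Gamma>) (isubst_pt \<sigma> t) (isubst_fm \<sigma> A)"
proof (induction arbitrary: \<sigma> rule: typing.induct)
  case (IApp \<Gamma> u A m)
  then show ?case
    using typing.IApp[of L _ _ "isubst_fm (up_tm \<sigma>) A" "subst_tm \<sigma> m"]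
    by (simp add: isubst_inst_fm wf_subst_tm)
next
  case (ILam \<Gamma> u A)
  from ILam.IH[OF wf_up_tm[OF ILam.prems]] show ?case
    by (auto intro!: typing.ILam simp: o_def isubst_shift_fm)
next
  case (Wit A m \<Gamma> u)
  then show ?case
    using typing.Wit[of L "isubst_fm (up_tm \<sigma>) A" "subst_tm \<sigma> m"]
    by (simp add: isubst_inst_fm wf_subst_tm wf_isubst_fm wf_up_tm)
next
  case (ExE \<Gamma> u A t C)
  from ExE.IH(1)[OF ExE.prems] ExE.IH(2)[OF wf_up_tm[OF ExE.prems]] show ?case
    by (auto intro!: typing.ExE simp: o_def isubst_shift_fm)
next
  case (PLam \<Gamma> u A)
  from PLam.IH[OF PLam.prems] show ?case
    by (auto intro!: typing.PLam simp: o_def pren_isubst_fm)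
next
  case (PApp \<Gamma> t A B)
  then show ?case
    using typing.PApp[of L _ _ "isubst_fm \<sigma> A" "isubst_fm (up_tm \<sigma>) B"]
    by (simp add: isubst_pinst_fm wf_isubst_fm wf_up_tm)
qed (auto intro: typing.intros simp: wf_isubst_fm)

lemma typing_pren:
  "typing L \<Gamma> t A \<Longrightarrow> typing L (map (pren_fm \<rho>) \<Gamma>) (pren_pt \<rho> t) (pren_fm \<rho> A)"
proof (induction arbitrary: \<rho> rule: typing.induct)
  case (IApp \<Gamma> u A m)
  then show ?case
    using typing.IApp[of L _ _ "pren_fm \<rho> A" m] by (simp add: pren_inst_fm)
next
  case (ILam \<Gamma> u A)
  from ILam.IH show ?case
    by (auto intro!: typing.ILam simp: o_def pren_isubst_fm)
next
  case (Wit A m \<Gamma> u)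
  then show ?case
    using typing.Wit[of L "pren_fm \<rho> A" m] by (simp add: pren_inst_fm)
next
  case (ExE \<Gamma> u A t C)
  from ExE.IH show ?case
    by (auto intro!: typing.ExE simp: o_def pren_isubst_fm)
next
  case (PLam \<Gamma> u A)
  from PLam.IH[of "up_ren \<rho>"] show ?case
    by (auto intro!: typing.PLam simp: o_def pren_pren_fm)
next
  case (PApp \<Gamma> t A B)
  then show ?case
    using typing.PApp[of L _ _ "pren_fm (up_ren \<rho>) A" "pren_fm \<rho> B"] by (simp add: pren_pinst_fm)
qed (auto intro: typing.intros)

lemma typing_exfalso:
  "typing L \<Gamma> u Bot \<Longrightarrow> wf_fm L A \<Longrightarrow> wf_tm L m \<Longrightarrow> typing L \<Gamma> (exfalso m A u) A"
proof (induction A arbitrary: \<Gamma> m u)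
  case (Imp A B)
  then show ?case by (auto intro!: typing.Lam Imp.IH typing_weaken)
next
  case (Uni A)
  from typing_isubst[OF Uni.prems(1), of shift_tm] Uni.prems show ?case
    by (auto intro!: typing.ILam Uni.IH simp: wf_subst_tm)
next
  case (Exi A)
  from typing_isubst[OF Exi.prems(1), of shift_tm] Exi.prems
  have "typing L (map (isubst_fm shift_tm) \<Gamma>)
    (exfalso (subst_tm shift_tm m) A (isubst_pt shift_tm u)) A"
    by (auto intro!: Exi.IH simp: wf_subst_tm)
  \<comment> \<open>Instantiating the bound variable by \<open>m\<close> undoes the shift of the
    context and turns \<open>A\<close> into the type required of the second component.\<close>
  from typing_isubst[OF this wf_case_nat[OF Exi.prems(3)]] Exi.prems show ?case
    by (auto intro!: typing.Wit simp: inst_fm_def isubst_isubst_fm case_nat_shift o_def)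
next
  case (Uni2 A)
  from typing_pren[OF Uni2.prems(1), of Suc] Uni2.prems show ?case
    by (auto intro!: typing.PLam Uni2.IH)
qed (auto intro: typing.intros)

lemma typing_psubst:
  "typing L \<Gamma> t A \<Longrightarrow> \<forall>X. wf_fm L (\<theta> X) \<Longrightarrow>
    typing L (map (psubst_fm \<theta>) \<Gamma>) (psubst_pt \<theta> t) (psubst_fm \<theta> A)"
proof (induction arbitrary: \<theta> rule: typing.induct)
  case (IApp \<Gamma> u A m)
  then show ?case
    using typing.IApp[of L _ _ "psubst_fm (ilift_ps \<theta>) A" m] by (simp add: psubst_inst_fm)
next
  case (ILam \<Gamma> u A)
  from ILam.IH[OF wf_ilift_ps[OF ILam.prems]] show ?case
    by (auto intro!: typing.ILam simp: o_def psubst_shift_fm)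
next
  case (Wit A m \<Gamma> u)
  then show ?case
    using typing.Wit[of L "psubst_fm (ilift_ps \<theta>) A" m]
    by (simp add: psubst_inst_fm wf_psubst_fm wf_ilift_ps)
next
  case (ExE \<Gamma> u A t C)
  from ExE.IH(1)[OF ExE.prems] ExE.IH(2)[OF wf_ilift_ps[OF ExE.prems]] show ?case
    by (auto intro!: typing.ExE simp: o_def psubst_shift_fm)
next
  case (Efq P \<Gamma> u)
  then have u: "typing L (map (psubst_fm \<theta>) \<Gamma>) (psubst_pt \<theta> u) Bot" by simp
  show ?case
  proof (cases P)
    \<comment> \<open>Well-formedness of the annotation supplies that of \<open>m\<close>, the
      witness that \<open>exfalso\<close> uses at existential quantifiers.\<close>
    case (PVar X m)
    with Efq u show ?thesis by (auto intro!: typing_exfalso wf_inst_fm)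
  qed (use Efq u in \<open>auto intro: typing.intros\<close>)
next
  case (PLam \<Gamma> u A)
  from PLam.IH[OF wf_up_ps[OF PLam.prems]] show ?case
    by (auto intro!: typing.PLam simp: o_def psubst_up_pren_fm)
next
  case (PApp \<Gamma> t A B)
  then show ?case
    using typing.PApp[of L _ _ "psubst_fm (up_ps \<theta>) A" "psubst_fm (ilift_ps \<theta>) B"]
    by (simp add: psubst_pinst_fm wf_psubst_fm wf_ilift_ps)
qed (auto intro: typing.intros simp: wf_psubst_fm)

lemma typing_subst:
  "typing L \<Gamma> t A \<Longrightarrow> \<forall>i<length \<Gamma>. typing L \<Delta> (\<tau> i) (\<Gamma> ! i) \<Longrightarrow> typing L \<Delta> (subst_pt \<tau> t) A"
proof (induction arbitrary: \<tau> \<Delta> rule: typing.induct)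
  case (Par A B \<Gamma> u C v)
  show ?case unfolding subst_pt.simps
    by (rule typing.Par[OF Par.hyps(1,2)]; rule Par.IH)
      (use Par.prems in \<open>auto simp: nth_Cons up_pt_def intro: typing.PV typing_weaken split: nat.split\<close>)
next
  case (Lam A \<Gamma> u B)
  show ?case unfolding subst_pt.simps
    by (rule typing.Lam[OF Lam.hyps(1)]; rule Lam.IH)
      (use Lam.prems in \<open>auto simp: nth_Cons up_pt_def intro: typing.PV typing_weaken split: nat.split\<close>)
next
  case (Case \<Gamma> u A B w1 C w2)
  show ?case unfolding subst_pt.simps
    by (rule typing.Case; rule Case.IH)
      (use Case.prems in \<open>auto simp: nth_Cons up_pt_def intro: typing.PV typing_weaken split: nat.split\<close>)
next
  case (ExE \<Gamma> u A t C)
  show ?case unfolding subst_pt.simps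
    by (rule typing.ExE; rule ExE.IH)
      (use ExE.prems in \<open>auto simp: nth_Cons up_pt_def intro: typing.PV typing_weaken[OF typing_isubst]
         split: nat.split\<close>)
next
  case (ILam \<Gamma> u A)
  then show ?case by (auto intro!: typing.ILam ILam.IH typing_isubst)
next
  case (PLam \<Gamma> u A)
  then show ?case by (auto intro!: typing.PLam PLam.IH typing_pren)
next
  case (App \<Gamma> t A B u)
  show ?case unfolding subst_pt.simps
    by (rule typing.App; rule App.IH[OF App.prems])
qed (auto intro: typing.intros)

lemma typing_inst:
  "typing L (A # \<Gamma>) t C \<Longrightarrow> typing L \<Gamma> u A \<Longrightarrow> typing L \<Gamma> (inst_pt u t) C"
  unfolding inst_pt_def
  by (rule typing_subst) (auto simp: nth_Cons intro: typing.PV split: nat.split)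

section \<open>Subject reduction\<close>

inductive_cases typing_PVE: "typing L \<Gamma> (PV i) C"
inductive_cases typing_TupE: "typing L \<Gamma> (Tup u v) C"
inductive_cases typing_Pr0E: "typing L \<Gamma> (Pr0 u) C"
inductive_cases typing_Pr1E: "typing L \<Gamma> (Pr1 u) C"
inductive_cases typing_AppE: "typing L \<Gamma> (App u v) C"
inductive_cases typing_LamE: "typing L \<Gamma> (Lam A v) C"
inductive_cases typing_In0E: "typing L \<Gamma> (In0 u) C"
inductive_cases typing_In1E: "typing L \<Gamma> (In1 u) C"
inductive_cases typing_CaseE: "typing L \<Gamma> (Case u A v B w) C"
inductive_cases typing_IAppE: "typing L \<Gamma> (IApp u m) C"
inductive_cases typing_ILamE: "typing L \<Gamma> (ILam u) C"
inductive_cases typing_WitE: "typing L \<Gamma> (Wit m u) C"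
inductive_cases typing_ExEE: "typing L \<Gamma> (ExE u A v) C"
inductive_cases typing_ParE: "typing L \<Gamma> (Par A B u v) C"
inductive_cases typing_EfqE: "typing L \<Gamma> (Efq P u) C"
inductive_cases typing_PLamE: "typing L \<Gamma> (PLam u) C"
inductive_cases typing_PAppE: "typing L \<Gamma> (PApp u B) C"

lemmas typing_elims = typing_PVE typing_TupE typing_Pr0E typing_Pr1E typing_AppE typing_LamE
  typing_In0E typing_In1E typing_CaseE typing_IAppE typing_ILamE typing_WitE typing_ExEE
  typing_ParE typing_EfqE typing_PLamE typing_PAppE

lemma typing_weaken_under: "typing L (A # \<Gamma>) t C \<Longrightarrow> typing L (A # B # \<Gamma>) (ren_pt (up_ren Suc) t) C"
  by (rule typing_ren) (auto simp: nth_Cons up_ren_def split: nat.splits)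

text \<open>An elimination constrains its head only through the type \<open>D\<close>, so the head
  may be exchanged. The version under one more binder is what the permutation rule needs.\<close>

lemma elim_typing:
  assumes "typing L \<Gamma> (elim u \<zeta>) C"
  shows "\<exists>D. typing L \<Gamma> u D \<and> (\<forall>u'. typing L \<Gamma> u' D \<longrightarrow> typing L \<Gamma> (elim u' \<zeta>) C) \<and>
    (\<forall>B u'. typing L (B # \<Gamma>) u' D \<longrightarrow> typing L (B # \<Gamma>) (elim u' (ren_stack_elt Suc \<zeta>)) C)"
proof (cases \<zeta>)
  case (SArg v)
  with assms obtain A where *: "typing L \<Gamma> u (Imp A C)" "typing L \<Gamma> v A"
    by (auto elim: typing_elims)
  then show ?thesis
    by (intro exI[of _ "Imp A C"])
      (auto simp: SArg intro: typing.App[OF _ *(2)] typing.App[OF _ typing_weaken[OF *(2)]])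
next
  case (STerm m)
  with assms show ?thesis by (auto elim!: typing_elims intro: typing.IApp)
next
  case SPr0
  with assms show ?thesis by (auto elim!: typing_elims intro: typing.Pr0)
next
  case SPr1
  with assms show ?thesis by (auto elim!: typing_elims intro: typing.Pr1)
next
  case (SCase A v B w)
  with assms have "typing L \<Gamma> u (Or A B)" "typing L (A # \<Gamma>) v C" "typing L (B # \<Gamma>) w C"
    by (auto elim: typing_elims)
  then show ?thesis
    by (intro exI[of _ "Or A B"]) (auto simp: SCase intro: typing.Case typing_weaken_under)
next
  case (SEx A w)
  with assms have *: "typing L \<Gamma> u (Exi A)"
    "typing L (A # map (isubst_fm shift_tm) \<Gamma>) w (isubst_fm shift_tm C)"
    by (auto elim!: typing_elims)
  have "typing L (B # \<Gamma>) (ExE u' A (ren_pt (up_ren Suc) w)) C" if "typing L (B # \<Gamma>) u' (Exi A)"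
    for B u'
    by (rule typing.ExE[OF that]) (simp add: typing_weaken_under *(2))
  with * show ?thesis by (intro exI[of _ "Exi A"]) (auto simp: SEx intro: typing.ExE)
next
  case (SPred B)
  with assms show ?thesis by (auto elim!: typing_elims intro: typing.PApp)
qed

lemma elims_typing:
  "typing L \<Gamma> (elims u \<sigma>) C \<Longrightarrow>
    \<exists>D. typing L \<Gamma> u D \<and> (\<forall>u'. typing L \<Gamma> u' D \<longrightarrow> typing L \<Gamma> (elims u' \<sigma>) C)"
proof (induction \<sigma> arbitrary: u)
  case Nil
  then show ?case by (auto simp: elims_def)
next
  case (Cons \<zeta> \<sigma>)
  then obtain D where D: "typing L \<Gamma> (elim u \<zeta>) D"
    "\<forall>u'. typing L \<Gamma> u' D \<longrightarrow> typing L \<Gamma> (elims u' \<sigma>) C" by (force simp: elims_def)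
  from elim_typing[OF D(1)] obtain D' where "typing L \<Gamma> u D'"
    "\<forall>u'. typing L \<Gamma> u' D' \<longrightarrow> typing L \<Gamma> (elim u' \<zeta>) D" by blast
  with D(2) show ?case by (intro exI[of _ D']) (auto simp: elims_def)
qed

lemma contracts_typing:
  assumes "contracts h h'" "typing L \<Gamma> h C"
  shows "typing L \<Gamma> h' C"
  using assms
proof (cases rule: contracts.cases)
  case (ibeta u m)
  with assms obtain A where A: "C = inst_fm m A" "wf_tm L m" "typing L (map (isubst_fm shift_tm) \<Gamma>) u A"
    by (auto elim!: typing_elims)
  from typing_isubst[OF A(3) wf_case_nat[OF A(2)]] show ?thesis
    by (simp add: ibeta A(1) o_def inst_fm_def isubst_isubst_fm case_nat_shift)
next
  case (pbeta u B)
  with assms obtain A where A: "C = pinst_fm B A" "wf_fm L B" "typing L (map (pren_fm Suc) \<Gamma>) u A"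
    by (auto elim!: typing_elims)
  have "\<forall>X. wf_fm L (case_nat B id_ps X)" using A(2) by (auto split: nat.split)
  from typing_psubst[OF A(3) this] show ?thesis
    by (simp add: pbeta A(1) o_def pinst_fm_def psubst_pren_fm)
next
  case (exE m u A v)
  with assms have A: "wf_tm L m" "typing L \<Gamma> u (inst_fm m A)"
    "typing L (A # map (isubst_fm shift_tm) \<Gamma>) v (isubst_fm shift_tm C)"
    by (auto elim!: typing_elims)
  from typing_isubst[OF A(3) wf_case_nat[OF A(1)]] A(2) show ?thesis
    by (auto simp: exE o_def isubst_isubst_fm case_nat_shift inst_fm_def intro: typing_inst)
next
  case (perm A B u v \<zeta>)
  with assms have "typing L \<Gamma> (elim (Par A B u v) \<zeta>) C" by simp
  from elim_typing[OF this] obtain D where D: "typing L \<Gamma> (Par A B u v) D"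
    "\<forall>B u'. typing L (B # \<Gamma>) u' D \<longrightarrow> typing L (B # \<Gamma>) (elim u' (ren_stack_elt Suc \<zeta>)) C"
    by blast
  from D(1) show ?thesis
    unfolding perm by (rule typing_ParE) (intro typing.Par D(2)[rule_format]; simp)
qed (use assms in \<open>auto elim!: typing_elims intro: typing_inst\<close>)

section \<open>Simulation by erased terms\<close>

text \<open>A class of proof terms that contains the derived ex falso terms and, unlike that set, is
  closed under reduction and under all substitutions.\<close>

inductive exf :: "('f, 'p) pt \<Rightarrow> bool" where
  "exf (Efq P u)"
| "exf u \<Longrightarrow> exf v \<Longrightarrow> exf (Tup u v)"
| "exf u \<Longrightarrow> exf (In0 u)"
| "exf u \<Longrightarrow> exf (Lam A u)"
| "exf u \<Longrightarrow> exf (ILam u)"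
| "exf u \<Longrightarrow> exf (Wit m u)"
| "exf u \<Longrightarrow> exf (PLam u)"

lemma exf_isubst: "exf t \<Longrightarrow> exf (isubst_pt \<sigma> t)"
  by (induction arbitrary: \<sigma> rule: exf.induct) (auto intro: exf.intros)

lemma exf_pren: "exf t \<Longrightarrow> exf (pren_pt \<rho> t)"
  by (induction arbitrary: \<rho> rule: exf.induct) (auto intro: exf.intros)

lemma exf_ren: "exf t \<Longrightarrow> exf (ren_pt \<rho> t)"
  by (induction arbitrary: \<rho> rule: exf.induct) (auto intro: exf.intros)

lemma exf_subst: "exf t \<Longrightarrow> exf (subst_pt \<tau> t)"
  by (induction arbitrary: \<tau> rule: exf.induct) (auto intro: exf.intros)

lemma exf_exfalso: "exf (exfalso m A u)"
  by (induction A arbitrary: m u) (auto intro: exf.intros exf_isubst)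

lemma exf_psubst: "exf t \<Longrightarrow> exf (psubst_pt \<theta> t)"
  by (induction arbitrary: \<theta> rule: exf.induct)
    (auto intro: exf.intros exf_exfalso split: fm.split)

text \<open>A relation instead of equality with \<open>er\<close>: predicate substitution can turn
  \<open>Efq\<close> into a compound term whose erasure is no longer \<open>UAbort\<close>. With
  \<open>sim_exf\<close> the erased term can stay the same.\<close>

inductive sim :: "('f, 'p) pt \<Rightarrow> utm \<Rightarrow> bool" where
  "sim (PV i) (UV i)"
| "sim u u' \<Longrightarrow> sim v v' \<Longrightarrow> sim (Tup u v) (UTup u' v')"
| "sim u u' \<Longrightarrow> sim (Pr0 u) (UPr0 u')"
| "sim u u' \<Longrightarrow> sim (Pr1 u) (UPr1 u')"
| "sim u u' \<Longrightarrow> sim v v' \<Longrightarrow> sim (App u v) (UApp u' v')"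
| "sim u u' \<Longrightarrow> sim (Lam A u) (ULam u')"
| "sim u u' \<Longrightarrow> sim (In0 u) (UIn0 u')"
| "sim u u' \<Longrightarrow> sim (In1 u) (UIn1 u')"
| "sim u u' \<Longrightarrow> sim v v' \<Longrightarrow> sim w w' \<Longrightarrow> sim (Case u A v B w) (UCase u' v' w')"
| "sim u u' \<Longrightarrow> sim (IApp u m) (UUnbox u')"
| "sim u u' \<Longrightarrow> sim (ILam u) (UBox u')"
| "sim u u' \<Longrightarrow> sim (Wit m u) (UIn0 u')"
| "sim u u' \<Longrightarrow> sim v v' \<Longrightarrow> sim (ExE u A v) (UCase u' v' v')"
| "sim u u' \<Longrightarrow> sim v v' \<Longrightarrow> sim (Par A B u v) (UPar u' v')"
| "sim u u' \<Longrightarrow> sim (PLam u) (UBox u')"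
| "sim u u' \<Longrightarrow> sim (PApp u B) (UUnbox u')"
| sim_exf: "exf u \<Longrightarrow> sim u UAbort"

lemma sim_er: "sim t (er t)"
  by (induction t) (auto intro: sim.intros exf.intros)

lemma sim_isubst: "sim t e \<Longrightarrow> sim (isubst_pt \<sigma> t) e"
  by (induction arbitrary: \<sigma> rule: sim.induct) (auto intro: sim.intros exf_isubst)

lemma sim_pren: "sim t e \<Longrightarrow> sim (pren_pt \<rho> t) e"
  by (induction arbitrary: \<rho> rule: sim.induct) (auto intro: sim.intros exf_pren)

lemma sim_psubst: "sim t e \<Longrightarrow> sim (psubst_pt \<theta> t) e"
  by (induction arbitrary: \<theta> rule: sim.induct) (auto intro: sim.intros exf_psubst)

lemma sim_ren: "sim t e \<Longrightarrow> sim (ren_pt \<rho> t) (uren \<rho> e)"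
  by (induction arbitrary: \<rho> rule: sim.induct) (auto intro: sim.intros exf_ren)

lemma sim_up: "\<forall>i. sim (\<tau> i) (\<tau>' i) \<Longrightarrow> \<forall>i. sim (up_pt \<tau> i) (uup \<tau>' i)"
  by (auto simp: up_pt_def uup_def intro: sim.intros sim_ren split: nat.split)

lemma sim_subst: "sim t e \<Longrightarrow> \<forall>i. sim (\<tau> i) (\<tau>' i) \<Longrightarrow> sim (subst_pt \<tau> t) (usubst \<tau>' e)"
  by (induction arbitrary: \<tau> \<tau>' rule: sim.induct)
    (auto intro!: sim.intros exf_subst simp: sim_up sim_isubst sim_pren)

lemma sim_inst: "sim t e \<Longrightarrow> sim u u' \<Longrightarrow> sim (inst_pt u t) (uinst u' e)"
  unfolding inst_pt_def uinst_def
  by (rule sim_subst) (auto intro: sim.intros split: nat.split)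

inductive_cases sim_UVE: "sim t (UV i)"
inductive_cases sim_UTupE: "sim t (UTup u v)"
inductive_cases sim_UPr0E: "sim t (UPr0 u)"
inductive_cases sim_UPr1E: "sim t (UPr1 u)"
inductive_cases sim_UAppE: "sim t (UApp u v)"
inductive_cases sim_ULamE: "sim t (ULam u)"
inductive_cases sim_UIn0E: "sim t (UIn0 u)"
inductive_cases sim_UIn1E: "sim t (UIn1 u)"
inductive_cases sim_UCaseE: "sim t (UCase u v w)"
inductive_cases sim_UBoxE: "sim t (UBox u)"
inductive_cases sim_UUnboxE: "sim t (UUnbox u)"
inductive_cases sim_UParE: "sim t (UPar u v)"
inductive_cases sim_UAbortE: "sim t UAbort"

lemmas sim_elims = sim_UVE sim_UTupE sim_UPr0E sim_UPr1E sim_UAppE sim_ULamE sim_UIn0E sim_UIn1E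
  sim_UCaseE sim_UBoxE sim_UUnboxE sim_UParE sim_UAbortE

section \<open>Simulation of stacks\<close>

inductive simk :: "('f, 'p) stack_elt \<Rightarrow> ustk \<Rightarrow> bool" where
  "sim u u' \<Longrightarrow> simk (SArg u) (KArg u')"
| "simk (STerm m) KUnbox"
| "simk SPr0 KPr0"
| "simk SPr1 KPr1"
| "sim v v' \<Longrightarrow> sim w w' \<Longrightarrow> simk (SCase A v B w) (KCase v' w')"
| "sim v v' \<Longrightarrow> simk (SEx A v) (KCase v' v')"
| "simk (SPred B) KUnbox"

lemma simk_ren: "simk \<zeta> \<xi> \<Longrightarrow> simk (ren_stack_elt \<rho> \<zeta>) (kren \<rho> \<xi>)"
  by (induction rule: simk.induct) (auto intro: simk.intros sim_ren)

lemma sim_elim: "sim t e \<Longrightarrow> simk \<zeta> \<xi> \<Longrightarrow> sim (elim t \<zeta>) (uelim e \<xi>)"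
  by (erule simk.cases) (auto intro: sim.intros)

lemma sim_uelimE:
  assumes "sim t (uelim e \<xi>)"
  obtains t' \<zeta> where "t = elim t' \<zeta>" "sim t' e" "simk \<zeta> \<xi>"
proof (cases \<xi>)
  case (KArg u)
  with assms that[of _ "SArg _"] show ?thesis by (auto elim!: sim_elims intro: simk.intros)
next
  case KUnbox
  with assms that[of _ "STerm _"] that[of _ "SPred _"] show ?thesis
    by (auto elim!: sim_elims simp: simk.intros)
next
  case KPr0
  with assms that[of _ SPr0] show ?thesis by (auto elim!: sim_elims intro: simk.intros)
next
  case KPr1
  with assms that[of _ SPr1] show ?thesis by (auto elim!: sim_elims intro: simk.intros)
next
  case (KCase v w)
  with assms that[of _ "SCase _ _ _ _"] that[of _ "SEx _ _"] show ?thesis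
    by (auto elim!: sim_elims simp: simk.intros)
qed

lemma elims_simps [simp]: "elims t [] = t" "elims t (\<zeta> # \<sigma>) = elims (elim t \<zeta>) \<sigma>"
  by (simp_all add: elims_def)

lemma sim_elims_uelims: "sim t e \<Longrightarrow> list_all2 simk \<rho> \<sigma> \<Longrightarrow> sim (elims t \<rho>) (uelims e \<sigma>)"
  by (induction \<rho> arbitrary: t e \<sigma>) (auto simp: list_all2_Cons1 sim_elim)

lemma sim_uelimsE:
  assumes "sim t (uelims e \<sigma>)"
  obtains t' \<rho> where "t = elims t' \<rho>" "sim t' e" "list_all2 simk \<rho> \<sigma>"
  using assms
proof (induction \<sigma> arbitrary: e thesis)
  case Nil
  then show ?case by (metis elims_simps(1) list_all2_Nil2 uelims_simps(1))
next
  case (Cons \<xi> \<sigma>)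
  from Cons.prems(2) have "sim t (uelims (uelim e \<xi>) \<sigma>)" by simp
  from Cons.IH[OF _ this] obtain t' \<rho> where *: "t = elims t' \<rho>" "sim t' (uelim e \<xi>)"
    "list_all2 simk \<rho> \<sigma>" by blast
  from *(2) obtain t'' \<zeta> where "t' = elim t'' \<zeta>" "sim t'' e" "simk \<zeta> \<xi>" by (rule sim_uelimE)
  with * show ?case by (intro Cons.prems(1)[of t'' "\<zeta> # \<rho>"]) auto
qed

text \<open>\<open>Efq\<close> has atomic type only, so at a compound type an \<open>exf\<close>
  term is an introduction. This and the next lemmas supply the redexes behind the abort
  rules.\<close>

lemma exf_And: "exf t \<Longrightarrow> typing L \<Gamma> t (And A B) \<Longrightarrow> \<exists>u v. t = Tup u v \<and> exf u \<and> exf v"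
  by (erule exf.cases) (auto elim: typing_elims)

lemma exf_Or: "exf t \<Longrightarrow> typing L \<Gamma> t (Or A B) \<Longrightarrow> \<exists>u. t = In0 u \<and> exf u"
  by (erule exf.cases) (auto elim: typing_elims)

lemma exf_Imp: "exf t \<Longrightarrow> typing L \<Gamma> t (Imp A B) \<Longrightarrow> \<exists>u. t = Lam A u \<and> exf u"
  by (erule exf.cases) (auto elim: typing_elims)

lemma exf_Uni: "exf t \<Longrightarrow> typing L \<Gamma> t (Uni A) \<Longrightarrow> \<exists>u. t = ILam u \<and> exf u"
  by (erule exf.cases) (auto elim: typing_elims)

lemma exf_Exi: "exf t \<Longrightarrow> typing L \<Gamma> t (Exi A) \<Longrightarrow> \<exists>m u. t = Wit m u \<and> exf u"
  by (erule exf.cases) (auto elim: typing_elims)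

lemma exf_Uni2: "exf t \<Longrightarrow> typing L \<Gamma> t (Uni2 A) \<Longrightarrow> \<exists>u. t = PLam u \<and> exf u"
  by (erule exf.cases) (auto elim: typing_elims)

text \<open>Erasure confuses the two universal quantifiers, and disjunction with existence. Typing
  discards the mismatched pairs of introduction and elimination and provides a genuine redex for
  each abort step.\<close>

lemma sim_ured:
  assumes "ured h h'" "sim t h" "typing L \<Gamma> t C"
  shows "\<exists>t'. contracts t t' \<and> sim t' h'"
  using assms(1)
proof (cases rule: ured.cases)
  case (beta u s)
  with assms(2) obtain A u' s' where "t = App (Lam A u') s'" "sim u' u" "sim s' s"
    by (auto elim!: sim_UAppE sim_ULamE)
  then show ?thesis unfolding beta by (blast intro: contracts.beta sim_inst)
next
  case box
  \<comment> \<open>An erased box does not record its quantifier, which leaves four shapes; the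
    second and fourth are ill-typed.\<close>
  with assms(2) consider m u where "t = IApp (ILam u) m" "sim u h'" | m u where "t = IApp (PLam u) m"
    | B u where "t = PApp (PLam u) B" "sim u h'" | B u where "t = PApp (ILam u) B"
    by (auto elim!: sim_UUnboxE sim_UBoxE)
  then show ?thesis
  proof cases
    case 1
    then show ?thesis by (blast intro: contracts.ibeta sim_isubst)
  next
    case 2
    with assms(3) show ?thesis by (auto elim!: typing_IAppE typing_PLamE)
  next
    case 3
    then show ?thesis by (blast intro: contracts.pbeta sim_psubst)
  next
    case 4
    with assms(3) show ?thesis by (auto elim!: typing_PAppE typing_ILamE)
  qed
next
  case (proj0 v)
  with assms(2) obtain u' v' where "t = Pr0 (Tup u' v')" "sim u' h'"
    by (auto elim!: sim_UPr0E sim_UTupE)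
  then show ?thesis by (blast intro: contracts.proj0)
next
  case (proj1 u)
  with assms(2) obtain u' v' where "t = Pr1 (Tup u' v')" "sim v' h'"
    by (auto elim!: sim_UPr1E sim_UTupE)
  then show ?thesis by (blast intro: contracts.proj1)
next
  case (case0 u v w)
  with assms(2) consider u' A v' B w' where "t = Case (In0 u') A v' B w'" "sim u' u" "sim v' v"
    | m u' A v' where "t = ExE (Wit m u') A v'" "sim u' u" "sim v' v"
    | m u' A v' B w' where "t = Case (Wit m u') A v' B w'"
    | u' A v' where "t = ExE (In0 u') A v'"
    by (auto elim!: sim_UCaseE sim_UIn0E)
  then show ?thesis
  proof cases
    case 1
    then show ?thesis unfolding case0 by (blast intro: contracts.case0 sim_inst)
  next
    case 2
    then show ?thesis unfolding case0 by (blast intro: contracts.exE sim_inst sim_isubst)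
  next
    case 3
    with assms(3) show ?thesis by (auto elim!: typing_CaseE typing_WitE)
  next
    case 4
    with assms(3) show ?thesis by (auto elim!: typing_ExEE typing_In0E)
  qed
next
  case (case1 u v w)
  with assms(2) consider u' A v' B w' where "t = Case (In1 u') A v' B w'" "sim u' u" "sim w' w"
    | u' A v' where "t = ExE (In1 u') A v'"
    by (auto elim!: sim_UCaseE sim_UIn1E)
  then show ?thesis
  proof cases
    case 1
    then show ?thesis unfolding case1 by (blast intro: contracts.case1 sim_inst)
  next
    case 2
    with assms(3) show ?thesis by (auto elim!: typing_ExEE typing_In1E)
  qed
next
  case (perm u v \<xi>)
  with assms obtain t' \<zeta> where t: "t = elim t' \<zeta>" "sim t' (UPar u v)" "simk \<zeta> \<xi>"
    by (blast elim: sim_uelimE)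
  from t(2) obtain A B u' v' where "t' = Par A B u' v'" "sim u' u" "sim v' v"
    by (blast elim: sim_UParE)
  with t show ?thesis unfolding perm
    by (blast intro: contracts.perm sim.intros sim_elim simk_ren)
next
  case (abort_app s)
  with assms(2) obtain r s' where t: "t = App r s'" "exf r" by (auto elim!: sim_UAppE sim_UAbortE)
  with assms(3) obtain A u where "r = Lam A u" "exf u" by (blast elim: typing_AppE dest: exf_Imp)
  with t show ?thesis unfolding abort_app inst_pt_def[symmetric]
    by (metis contracts.beta exf_subst inst_pt_def sim_exf)
next
  case abort_unbox
  with assms(2) consider r m where "t = IApp r m" "exf r" | r B where "t = PApp r B" "exf r"
    by (auto elim!: sim_UUnboxE sim_UAbortE)
  then show ?thesis
  proof cases
    case 1
    with assms(3) obtain u where "r = ILam u" "exf u" by (blast elim: typing_IAppE dest: exf_Uni)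
    with 1 show ?thesis unfolding abort_unbox by (blast intro: contracts.ibeta sim_exf exf_isubst)
  next
    case 2
    with assms(3) obtain u where "r = PLam u" "exf u" by (blast elim: typing_PAppE dest: exf_Uni2)
    with 2 show ?thesis unfolding abort_unbox by (blast intro: contracts.pbeta sim_exf exf_psubst)
  qed
next
  case abort_pr0
  with assms(2) obtain r where t: "t = Pr0 r" "exf r" by (auto elim!: sim_UPr0E sim_UAbortE)
  with assms(3) obtain B where "typing L \<Gamma> r (And C B)" by (auto elim: typing_Pr0E)
  from exf_And[OF t(2) this] obtain u v where "r = Tup u v" "exf u" by blast
  with t show ?thesis unfolding abort_pr0 by (blast intro: contracts.proj0 sim_exf)
next
  case abort_pr1
  with assms(2) obtain r where t: "t = Pr1 r" "exf r" by (auto elim!: sim_UPr1E sim_UAbortE)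
  with assms(3) obtain B where "typing L \<Gamma> r (And B C)" by (auto elim: typing_Pr1E)
  from exf_And[OF t(2) this] obtain u v where "r = Tup u v" "exf v" by blast
  with t show ?thesis unfolding abort_pr1 by (blast intro: contracts.proj1 sim_exf)
next
  case (abort_case v w)
  with assms(2) consider r A v' B w' where "t = Case r A v' B w'" "exf r" "sim v' v"
    | r A v' where "t = ExE r A v'" "exf r" "sim v' v"
    by (auto elim!: sim_UCaseE sim_UAbortE)
  then show ?thesis
  proof cases
    case 1
    with assms(3) obtain u where "r = In0 u" "exf u" by (blast elim: typing_CaseE dest: exf_Or)
    with 1 show ?thesis unfolding abort_case by (blast intro: contracts.case0 sim_inst sim_exf)
  next
    case 2
    with assms(3) obtain m u where "r = Wit m u" "exf u" by (blast elim: typing_ExEE dest: exf_Exi)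
    with 2 show ?thesis unfolding abort_case
      by (blast intro: contracts.exE sim_inst sim_isubst sim_exf)
  qed
qed

section \<open>Head reduction follows evaluation\<close>

datatype ('f, 'p) frame =
    FL "('f, 'p) fm" "('f, 'p) fm" "('f, 'p) pt"
  | FR "('f, 'p) fm" "('f, 'p) fm" "('f, 'p) pt"

primrec partner :: "('f, 'p) frame \<Rightarrow> ('f, 'p) pt" where
  "partner (FL A B v) = v"
| "partner (FR A B v) = v"

primrec channel :: "('f, 'p) frame \<Rightarrow> ('f, 'p) fm" where
  "channel (FL A B v) = Imp A B"
| "channel (FR A B v) = Imp B A"

primrec wrap :: "('f, 'p) frame \<Rightarrow> ('f, 'p) par_ctxt \<Rightarrow> ('f, 'p) par_ctxt" where
  "wrap (FL A B v) C = ParL A B C v"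
| "wrap (FR A B v) C = ParR A B v C"

text \<open>Frames are listed from the innermost one outwards, as in \<open>ev\<close>, so the
  channel with index \<open>n\<close> at the hole is bound by \<open>D ! n\<close>.\<close>

definition ctxt :: "('f, 'p) frame list \<Rightarrow> ('f, 'p) par_ctxt \<Rightarrow> ('f, 'p) par_ctxt" where
  "ctxt D C = foldl (\<lambda>C f. wrap f C) C D"

lemma ctxt_simps [simp]: "ctxt [] C = C" "ctxt (f # D) C = ctxt D (wrap f C)"
  by (simp_all add: ctxt_def)

lemma ctxt_append: "ctxt (E @ D) C = ctxt D (ctxt E C)"
  by (simp add: ctxt_def)

abbreviation plugs :: "('f, 'p) frame list \<Rightarrow> ('f, 'p) pt \<Rightarrow> ('f, 'p) pt" where
  "plugs D t \<equiv> plug (ctxt D Hole) t"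

lemma plug_ctxt: "plug (ctxt D C) t = plugs D (plug C t)"
proof (induction D arbitrary: C t)
  case (Cons f D)
  from Cons[of "wrap f C" t] Cons[of "wrap f Hole" "plug C t"] show ?case by (cases f) simp_all
qed simp

lemma depth_ctxt: "depth (ctxt D C) = length D + depth C"
proof (induction D arbitrary: C)
  case (Cons f D)
  then show ?case by (cases f) simp_all
qed simp

lemma hole_pos_ctxt: "hole_pos (ctxt D C) = hole_pos (ctxt D Hole) + hole_pos C"
proof (induction D arbitrary: C)
  case (Cons f D)
  from Cons[of "wrap f C"] Cons[of "wrap f Hole"] show ?case by (cases f) simp_all
qed simp

section \<open>Starting symbols and leftmost head redexes\<close>

lemma elem_procs_plug:
  "k < length (elem_procs t) \<Longrightarrow> hole_pos C + k < length (elem_procs (plug C t)) \<and>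
    elem_procs (plug C t) ! (hole_pos C + k) = elem_procs t ! k"
  by (induction C) (auto simp: nth_append add.assoc)

lemma elem_procs_elim [simp]: "elem_procs (elim t \<zeta>) = [elim t \<zeta>]"
  by (cases \<zeta>) simp_all

lemma elims_elim: "\<exists>t' \<zeta>'. elims (elim t \<zeta>) \<sigma> = elim t' \<zeta>'"
  by (induction \<sigma> arbitrary: t \<zeta>) auto

lemma contracts_elim: "contracts h h' \<Longrightarrow> \<exists>t \<zeta>. h = elim t \<zeta>"
  by (erule contracts.cases) (metis elim.simps)+

lemma elim_neq_Wit [simp]: "elim t \<zeta> \<noteq> Wit m u"
  by (cases \<zeta>) simp_all

text \<open>Both \<open>r\<xi>\<sigma>\<close> and \<open>a s \<rho>\<close> are eliminations, so a
  process that is a pair contains no starting symbol.\<close>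

lemma head_contr_elem_procs:
  assumes "head_contr t i t'"
  shows "i < length (elem_procs t) \<and> (\<exists>r \<zeta>. elem_procs t ! i = elim r \<zeta>)"
  using assms
proof (cases rule: head_contr.cases)
  case (elementary h h' D \<sigma>)
  then obtain r \<zeta> where "elims h \<sigma> = elim r \<zeta>" by (metis contracts_elim elims_elim)
  with elem_procs_plug[of 0 "elims h \<sigma>" D] elementary show ?thesis by auto
next
  case (comm_left D A B C s \<rho> v)
  obtain r \<zeta> where e: "elims (App (PV (depth C)) s) \<rho> = elim r \<zeta>"
    using elims_elim[of "PV (depth C)" "SArg s" \<rho>] by auto
  with elem_procs_plug[of 0 "elim r \<zeta>" C]
  have "hole_pos C < length (elem_procs (plug C (elim r \<zeta>)))"
    "elem_procs (plug C (elim r \<zeta>)) ! hole_pos C = elim r \<zeta>" by auto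
  with elem_procs_plug[of "hole_pos C" "Par A B (plug C (elim r \<zeta>)) v" D] show ?thesis
    by (auto simp: comm_left e nth_append)
next
  case (comm_right D A B v C s \<rho>)
  obtain r \<zeta> where e: "elims (App (PV (depth C)) s) \<rho> = elim r \<zeta>"
    using elims_elim[of "PV (depth C)" "SArg s" \<rho>] by auto
  with elem_procs_plug[of 0 "elim r \<zeta>" C]
  have "hole_pos C < length (elem_procs (plug C (elim r \<zeta>)))"
    "elem_procs (plug C (elim r \<zeta>)) ! hole_pos C = elim r \<zeta>" by auto
  with elem_procs_plug[of "length (elem_procs v) + hole_pos C" "Par A B v (plug C (elim r \<zeta>))" D]
  show ?thesis by (auto simp: comm_right e add.assoc)
qed

lemma herbrand_elem_procs: "herbrand_nf u \<Longrightarrow> \<forall>p\<in>set (elem_procs u). \<exists>m v. p = Wit m v"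
  by (induction rule: herbrand_nf.induct) auto

lemma herbrand_head_normal:
  assumes "herbrand_nf u"
  shows "head_normal u"
  unfolding head_normal_def head_red_def
  using herbrand_elem_procs[OF assms] head_contr_elem_procs
  by (metis elim_neq_Wit nth_mem)

text \<open>The partners in \<open>FR\<close> frames are the processes to the left of the hole. If
  they are Herbrand normal, a redex at the hole is the leftmost one.\<close>

definition done_left :: "('f, 'p) frame list \<Rightarrow> bool" where
  "done_left D \<longleftrightarrow> (\<forall>A B v. FR A B v \<in> set D \<longrightarrow> herbrand_nf v)"

lemma done_left_elem_procs:
  "done_left D \<Longrightarrow> j < hole_pos (ctxt D Hole) \<Longrightarrow> \<exists>m v. elem_procs (plugs D t) ! j = Wit m v"
proof (induction D arbitrary: t j)
  case (Cons f D)
  have D: "done_left D" using Cons.prems(1) by (auto simp: done_left_def)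
  show ?case
  proof (cases "j < hole_pos (ctxt D Hole)")
    case True
    from Cons.IH[OF D this] show ?thesis by (simp add: plug_ctxt[of D "wrap f Hole"])
  next
    case False
    with Cons.prems(2) obtain A B w where f: "f = FR A B w"
      by (cases f) (auto simp: hole_pos_ctxt[of D "wrap _ _"] hole_pos_ctxt[of D "ParL _ _ _ _"])
    define k where "k = j - hole_pos (ctxt D Hole)"
    from False Cons.prems(2) have k: "j = hole_pos (ctxt D Hole) + k" "k < length (elem_procs w)"
      by (auto simp: k_def f hole_pos_ctxt[of D "ParR _ _ _ _"])
    have "herbrand_nf w" using Cons.prems(1) by (auto simp: done_left_def f)
    from bspec[OF herbrand_elem_procs[OF this] nth_mem[OF k(2)]]
    show ?thesis
      using elem_procs_plug[of k "Par A B w t" "ctxt D Hole"] k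
      by (auto simp: f plug_ctxt[of D "ParR _ _ _ _"] nth_append)
  qed
qed simp

lemma head_redI:
  assumes "done_left D" "head_contr (plugs D t) (hole_pos (ctxt D Hole)) t'"
  shows "plugs D t \<succ> t'"
  unfolding head_red_def
  using assms(2) done_left_elem_procs[OF assms(1)] head_contr_elem_procs
  by (metis elim_neq_Wit)

lemma head_red_contracts:
  "done_left D \<Longrightarrow> contracts h h' \<Longrightarrow> plugs D (elims h \<sigma>) \<succ> plugs D (elims h' \<sigma>)"
  by (intro head_redI head_contr.elementary)

text \<open>The result type of the channel as seen from the hole, and hence the type of the dummy
  variable in the message.\<close>

primrec received :: "('f, 'p) frame \<Rightarrow> ('f, 'p) fm" where
  "received (FL A B v) = B"
| "received (FR A B v) = A"

lemma head_red_comm: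
  assumes D: "done_left D" and n: "n < length D"
  shows "plugs D (elims (App (PV n) s) \<rho>) \<succ>
    plugs D (subst_pt (comm_subst (received (D ! n)) s n) (partner (D ! n)))"
proof (rule head_redI[OF D])
  \<comment> \<open>\<open>E\<close> is the part of the context inside the binder of channel
    \<open>n\<close>, \<open>D'\<close> the part outside it.\<close>
  define E where "E = take n D"
  define D' where "D' = drop (Suc n) D"
  have split: "D = E @ D ! n # D'" and len: "length E = n"
    using n by (simp_all add: E_def D'_def id_take_nth_drop[symmetric])
  have plugs: "plugs D t = plugs D' (plug (wrap (D ! n) (ctxt E Hole)) t)" for t
    by (subst split) (simp add: ctxt_append plug_ctxt[of D' "wrap _ _"])
  have pos: "hole_pos (ctxt D Hole) = hole_pos (ctxt D' Hole) + hole_pos (wrap (D ! n) (ctxt E Hole))"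
    by (subst split) (simp add: ctxt_append hole_pos_ctxt[of D' "wrap _ _"])
  have "depth (ctxt E Hole) = n" by (simp add: depth_ctxt len)
  then show "head_contr (plugs D (elims (App (PV n) s) \<rho>)) (hole_pos (ctxt D Hole))
     (plugs D (subst_pt (comm_subst (received (D ! n)) s n) (partner (D ! n))))"
    unfolding plugs pos
    using head_contr.comm_left[where D = "ctxt D' Hole" and C = "ctxt E Hole" and s = s and \<rho> = \<rho>]
      head_contr.comm_right[where D = "ctxt D' Hole" and C = "ctxt E Hole" and s = s and \<rho> = \<rho>]
    by (cases "D ! n") (simp_all add: add.assoc)
qed

text \<open>All partners share the conclusion \<open>C\<close>. Each is typed under its own end of
  the channel and the channels further out; the existential \<open>A\<close> is the type of the
  messages sent from the hole.\<close>

primrec wt_frames :: "('f, 'p) lang \<Rightarrow> ('f, 'p) frame list \<Rightarrow> ('f, 'p) fm \<Rightarrow> bool" where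
  "wt_frames L [] C \<longleftrightarrow> True"
| "wt_frames L (f # D) C \<longleftrightarrow> wf_fm L (received f) \<and>
    (\<exists>A. channel f = Imp A (received f) \<and>
      typing L (Imp (received f) A # map channel D) (partner f) C) \<and> wt_frames L D C"

lemma wt_frames_nth:
  "wt_frames L D C \<Longrightarrow> n < length D \<Longrightarrow> wf_fm L (received (D ! n)) \<and>
    (\<exists>A. channel (D ! n) = Imp A (received (D ! n)) \<and>
      typing L (Imp (received (D ! n)) A # drop (Suc n) (map channel D)) (partner (D ! n)) C)"
proof (induction D arbitrary: n)
  case (Cons f D)
  then show ?case by (cases n) auto
qed simp

lemma sim_comm_subst: "sim s s' \<Longrightarrow> sim (comm_subst B s n i) (ucomm s' n i)"
  by (auto simp: comm_subst_def ucomm_def intro: sim.intros sim_ren split: nat.split)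

text \<open>The message has type \<open>B \<rightarrow> A\<close>, and the remaining variables of
  \<open>v\<close> are found \<open>n\<close> places further on in \<open>\<Gamma>\<close>. This is
  subject reduction for communication.\<close>

lemma typing_comm_subst:
  assumes v: "typing L (Imp B A # drop (Suc n) \<Gamma>) v C" and "typing L \<Gamma> s A" "wf_fm L B"
  shows "typing L \<Gamma> (subst_pt (comm_subst B s n) v) C"
proof (rule typing_subst[OF v], intro allI impI)
  fix i assume "i < length (Imp B A # drop (Suc n) \<Gamma>)"
  then show "typing L \<Gamma> (comm_subst B s n i) ((Imp B A # drop (Suc n) \<Gamma>) ! i)"
    using assms(2,3)
    by (auto simp: comm_subst_def ac_simps split: nat.split intro!: typing.intros typing_weaken)
qed

lemma typed_value:
  assumes "typing L \<Gamma> t (Exi A)" and "sim t (UIn0 e) \<or> sim t UAbort"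
  shows "herbrand_nf t"
  using assms(2)
proof
  assume "sim t (UIn0 e)"
  with assms(1) show ?thesis by (auto elim!: sim_UIn0E typing_In0E intro: herbrand_nf.intros)
next
  assume "sim t UAbort"
  then have "exf t" by (auto elim: sim_UAbortE)
  from exf_Exi[OF this assms(1)] show ?thesis by (auto intro: herbrand_nf.intros)
qed

text \<open>Each reduction or communication in the evaluation is matched by one head reduction at
  the hole. Evaluation goes from left to right, so \<open>done_left\<close> is preserved and the
  redex at the hole is the one that head reduction selects.\<close>

lemma sim_ev:
  assumes "ev F e U" "list_all2 (\<lambda>f v. sim (partner f) v) D F" "wt_frames L D (Exi A)"
    "done_left D" "sim t e" "typing L (map channel D) t (Exi A)"
  shows "\<exists>T. sim T U \<and> herbrand_nf T \<and> typing L (map channel D) T (Exi A) \<and>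
    head_red\<^sup>*\<^sup>* (plugs D t) (plugs D T)"
  using assms
proof (induction arbitrary: D t rule: ev.induct)
  case (value_in F e)
  then show ?case using typed_value by blast
next
  case (value_abort F)
  then show ?case using typed_value by blast
next
  case (step h h' F \<sigma> U)
  from step.prems(4) obtain r \<rho> where t: "t = elims r \<rho>" "sim r h" "list_all2 simk \<rho> \<sigma>"
    by (rule sim_uelimsE)
  from elims_typing[OF step.prems(5)[unfolded t(1)]] obtain C where
    C: "typing L (map channel D) r C"
    "\<forall>r'. typing L (map channel D) r' C \<longrightarrow> typing L (map channel D) (elims r' \<rho>) (Exi A)"
    by blast
  from sim_ured[OF step.hyps(1) t(2) C(1)] obtain r' where r': "contracts r r'" "sim r' h'" by blast
  from step.IH[OF step.prems(1-3) sim_elims_uelims[OF r'(2) t(3)] C(2)[rule_format, OF contracts_typing[OF r'(1) C(1)]]]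
  show ?case
    using head_red_contracts[OF step.prems(3) r'(1)] t(1) by (meson converse_rtranclp_into_rtranclp)
next
  case (comm n F s U \<sigma>)
  from comm.prems(4) obtain r \<rho> where t: "t = elims r \<rho>" "sim r (UApp (UV n) s)"
    by (rule sim_uelimsE)
  from t(2) obtain s' where r: "r = App (PV n) s'" "sim s' s" by (auto elim!: sim_elims)
  have n: "n < length D" "sim (partner (D ! n)) (F ! n)"
    using comm.hyps(1) comm.prems(1) by (auto simp: list_all2_conv_all_nth)
  from elims_typing[OF comm.prems(5)[unfolded t(1)]] obtain C where "typing L (map channel D) r C"
    by blast
  with wt_frames_nth[OF comm.prems(2) n(1)] n(1) obtain A' where
    A': "wf_fm L (received (D ! n))" "typing L (map channel D) s' A'"
    "typing L (Imp (received (D ! n)) A' # drop (Suc n) (map channel D)) (partner (D ! n)) (Exi A)"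
    by (auto simp: r elim!: typing_elims)
  \<comment> \<open>Only the message survives: the stack is discarded with the old process, and the
    partner that replaces it has the common conclusion type.\<close>
  let ?v = "subst_pt (comm_subst (received (D ! n)) s' n) (partner (D ! n))"
  have "sim ?v (usubst (ucomm s n) (F ! n))"
    using n r by (auto intro: sim_subst sim_comm_subst)
  from comm.IH[OF comm.prems(1-3) this typing_comm_subst[OF A'(3,2,1)]] show ?case
    using head_red_comm[OF comm.prems(3) n(1), of s' \<rho>] t(1) r(1)
    by (meson converse_rtranclp_into_rtranclp)
next
  case (par v F u U V)
  from par.prems(4) obtain A' B u' v' where t: "t = Par A' B u' v'" "sim u' u" "sim v' v"
    by (auto elim!: sim_elims)
  from par.prems(5)[unfolded t(1)] have ty: "wf_fm L A'" "wf_fm L B"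
    "typing L (Imp A' B # map channel D) u' (Exi A)" "typing L (Imp B A' # map channel D) v' (Exi A)"
    by (auto elim!: typing_elims)
  \<comment> \<open>The left process comes first, with the right one still unevaluated; an
    \<open>FL\<close> frame adds nothing to the left of the hole.\<close>
  have "\<exists>T. sim T U \<and> herbrand_nf T \<and> typing L (map channel (FL A' B v' # D)) T (Exi A) \<and>
    head_red\<^sup>*\<^sup>* (plugs (FL A' B v' # D) u') (plugs (FL A' B v' # D) T)"
    by (rule par.IH(1)) (use par.prems t ty in \<open>auto simp: done_left_def\<close>)
  then obtain T1 where T1: "sim T1 U" "herbrand_nf T1" "typing L (Imp A' B # map channel D) T1 (Exi A)"
    "head_red\<^sup>*\<^sup>* (plugs D t) (plugs D (Par A' B T1 v'))"
    by (auto simp: plug_ctxt[of D "ParL _ _ _ _"] t(1))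
  \<comment> \<open>The hole moves to the right process. Its partner is now \<open>T1\<close>, whose
    Herbrand normality keeps \<open>done_left\<close> true.\<close>
  have "\<exists>T. sim T V \<and> herbrand_nf T \<and> typing L (map channel (FR A' B T1 # D)) T (Exi A) \<and>
    head_red\<^sup>*\<^sup>* (plugs (FR A' B T1 # D) v') (plugs (FR A' B T1 # D) T)"
    by (rule par.IH(2)) (use par.prems t ty T1 in \<open>auto simp: done_left_def\<close>)
  then obtain T2 where T2: "sim T2 V" "herbrand_nf T2" "typing L (Imp B A' # map channel D) T2 (Exi A)"
    "head_red\<^sup>*\<^sup>* (plugs D (Par A' B T1 v')) (plugs D (Par A' B T1 T2))"
    by (auto simp: plug_ctxt[of D "ParR _ _ _ _"])
  with T1 ty show ?case
    by (intro exI[of _ "Par A' B T1 T2"] conjI)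
      (auto intro: sim.intros herbrand_nf.intros typing.Par)
qed

section \<open>The Herbrand disjunction\<close>

lemma wf_disjunction: "wf_fm L B \<Longrightarrow> \<forall>C\<in>set Bs. wf_fm L C \<Longrightarrow> wf_fm L (disjunction B Bs)"
  by (induction Bs arbitrary: B) auto

lemma typing_disjunction:
  "typing L \<Gamma> s C \<Longrightarrow> C \<in> set (B # Bs) \<Longrightarrow> wf_fm L B \<Longrightarrow> \<forall>C\<in>set Bs. wf_fm L C \<Longrightarrow>
    \<exists>s'. typing L \<Gamma> s' (disjunction B Bs)"
proof (induction Bs arbitrary: B)
  case (Cons B' Bs)
  show ?case
  proof (cases "C = B")
    case True
    with Cons.prems show ?thesis by (auto intro: typing.In0 wf_disjunction)
  next
    case False
    with Cons.prems have "\<exists>s'. typing L \<Gamma> s' (disjunction B' Bs)" by (intro Cons.IH) auto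
    with Cons.prems show ?thesis by (auto intro: typing.In1)
  qed
qed auto

lemma herbrand_wf_witness:
  "herbrand_nf u \<Longrightarrow> typing L \<Gamma> u (Exi A) \<Longrightarrow> Wit m v \<in> set (elem_procs u) \<Longrightarrow> wf_tm L m"
  by (induction arbitrary: \<Gamma> rule: herbrand_nf.induct) (auto elim!: typing_elims)

text \<open>Each pair is replaced by a proof of \<open>C\<close> while the parallel operators stay,
  so all channels remain bound. \<open>\<Delta>\<close> is arbitrary because the components are
  typed under these channels.\<close>

lemma herbrand_typing:
  assumes "herbrand_nf u" "typing L \<Gamma> u (Exi A)"
    and "\<And>m v \<Delta> s. Wit m v \<in> set (elem_procs u) \<Longrightarrow> typing L \<Delta> s (inst_fm m A) \<Longrightarrow> \<exists>s'. typing L \<Delta> s' C"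
  shows "\<exists>s'. typing L \<Gamma> s' C"
  using assms
proof (induction arbitrary: \<Gamma> rule: herbrand_nf.induct)
  case (1 m u)
  then show ?case by (auto elim!: typing_elims)
next
  case (2 u v A' B)
  from 2(5) have ty: "wf_fm L A'" "wf_fm L B" "typing L (Imp A' B # \<Gamma>) u (Exi A)"
    "typing L (Imp B A' # \<Gamma>) v (Exi A)" by (auto elim!: typing_elims)
  from 2(3)[OF ty(3)] 2(4)[OF ty(4)] 2(6) obtain s s' where
    "typing L (Imp A' B # \<Gamma>) s C" "typing L (Imp B A' # \<Gamma>) s' C" by (metis Un_iff elem_procs.simps(1) set_append)
  with ty show ?case by (blast intro: typing.Par)
qed

lemma herbrand_elem_procs_Cons:
  assumes "herbrand_nf u"
  shows "\<exists>m0 v0 mvs. elem_procs u = map (\<lambda>(m, v). Wit m v) ((m0, v0) # mvs)"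
proof -
  have "\<exists>mvs. ps = map (\<lambda>(m, v). Wit m v) mvs" if "\<forall>p\<in>set ps. \<exists>m v. p = Wit m v" for ps :: "('a, 'b) pt list"
    using that by (induction ps) (force simp: Cons_eq_map_conv)+
  from this[OF herbrand_elem_procs[OF assms]] obtain mvs where
    mvs: "elem_procs u = map (\<lambda>(m, v). Wit m v) mvs" by blast
  moreover have "elem_procs u \<noteq> []" using assms by (induction rule: herbrand_nf.induct) auto
  ultimately show ?thesis by (cases mvs) auto
qed

theorem theorem5p9:
  fixes L :: "('f, 'p) lang" and A :: "('f, 'p) fm" and t :: "('f, 'p) pt"
  assumes "wf_fm L (Exi A)" and "typing L [] t (Exi A)"
  shows "\<exists>u m0 v0 mvs.
    head_red\<^sup>*\<^sup>* t u \<and> head_normal u \<and> typing L [] u (Exi A) \<and>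
    herbrand_nf u \<and> elem_procs u = map (\<lambda>(m, v). Wit m v) ((m0, v0) # mvs) \<and>
    provable L (disjunction (inst_fm m0 A) (map (\<lambda>(m, v). inst_fm m A) mvs))"
proof -
  from typing_Exi_ev[OF assms(2)] obtain U where "ev [] (er t) U" by blast
  \<comment> \<open>At the root there are no frames: the conditions on the context are trivial and
    \<open>plugs []\<close> is the identity.\<close>
  from sim_ev[OF this, of "[]" L A t] assms(2) sim_er[of t] obtain u where
    u: "herbrand_nf u" "typing L [] u (Exi A)" "head_red\<^sup>*\<^sup>* t u"
    by (auto simp: done_left_def)
  from herbrand_elem_procs_Cons[OF u(1)] obtain m0 v0 mvs where
    procs: "elem_procs u = map (\<lambda>(m, v). Wit m v) ((m0, v0) # mvs)" by blast
  let ?Bs = "map (\<lambda>(m, v). inst_fm m A) mvs"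
  \<comment> \<open>The typing rules for injections ask that the other disjuncts be
    well-formed.\<close>
  have wf: "wf_fm L (inst_fm m A)" if "(m, v) \<in> set ((m0, v0) # mvs)" for m v
  proof -
    from that have "Wit m v \<in> set (elem_procs u)" unfolding procs by force
    from herbrand_wf_witness[OF u(1,2) this] assms(1) show ?thesis by (simp add: wf_inst_fm)
  qed
  have "\<exists>s. typing L [] s (disjunction (inst_fm m0 A) ?Bs)"
  proof (rule herbrand_typing[OF u(1,2)])
    fix m v \<Delta> s assume "Wit m v \<in> set (elem_procs u)" and s: "typing L \<Delta> s (inst_fm m A)"
    then have "(m, v) \<in> set ((m0, v0) # mvs)" by (auto simp: procs)
    then have "inst_fm m A \<in> set (inst_fm m0 A # ?Bs)" by force
    then show "\<exists>s'. typing L \<Delta> s' (disjunction (inst_fm m0 A) ?Bs)"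
      by (rule typing_disjunction[OF s]) (use wf in auto)
  qed
  with u procs herbrand_head_normal[OF u(1)] show ?thesis unfolding provable_def by blast
qed

end
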